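(* Let $A$ be a commutative $\mathbb{Q}$-algebra with unit element of dimension $\dim_{\mathbb{Q}}A=3$. Let $\Lambda$ be an order in $A$. Then there exists a number $\mu(\Lambda)\in\mathbb{N}$ with $$\tau(\Lambda)=2^{t(\Lambda)},\qquad\text{where}\qquad t(\Lambda)=|\{p \text{ prime number}\ :\ p \text{ divides } \mu(\Lambda)\}|.$$ Here $\tau(\Lambda)$ is the number of $w$-equivalence classes in the set of full lattices $L$ in $A$ with $\mathcal{O}(L)=\Lambda$.
   Context: $\mathbb{N}=\{1,2,\dots\}$. A full lattice in $A$ is a finitely generated $\mathbb{Z}$-submodule of $A$ which generates $A$ over $\mathbb{Q}$; $\mathcal{L}(A)$ is the set of full lattices. It is a commutative semigroup with $L_1\cdot L_2=\{\text{finite sums }\sum a_ib_i : a_i\in L_1,b_i\in L_2\}$. An order in $A$ is a full lattice $\Lambda$ with $1_A\in\Lambda$ and $\Lambda\cdot\Lambda\subset\Lambda$. For $L\in\mathcal{L}(A)$ the order of $L$ is $\mathcal{O}(L)=\{a\in A : aL\subset L\}$. Two full lattices $L_1,L_2$ are $w$-equivalent ($L_1\sim_w L_2$) if $L_1=L_2$ or there exist $X_1,X_2\in\mathcal{L}(A)$ with $L_1X_1=L_2$ and $L_2X_2=L_1$. $w$-equivalent full lattices have the same order, and the number $\tau(\Lambda)$ is finite. *)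

theory Defs
  imports Complex_Main "HOL-Computational_Algebra.Primes"
begin

abbreviation int_scale :: "int \<Rightarrow> 'a::comm_ring_1 \<Rightarrow> 'a"
  where "int_scale n x \<equiv> of_int n * x"

lemma module_int_scale: "module (int_scale :: int \<Rightarrow> 'a::comm_ring_1 \<Rightarrow> 'a)"
  by unfold_locales (simp_all add: algebra_simps)

text \<open>The algebra is the whole type \<open>'a\<close>; \<open>scale\<close> is its rational scalar multiplication.\<close>

locale rat_algebra = rat: vector_space scale
  for scale :: "rat \<Rightarrow> 'a::comm_ring_1 \<Rightarrow> 'a" +
  assumes scale_mult_left: "scale r x * y = scale r (x * y)"
begin

definition full_lattice :: "'a set \<Rightarrow> bool"
  where "full_lattice L \<longleftrightarrow>
    (\<exists>S. finite S \<and> L = module.span int_scale S) \<and> rat.span L = UNIV"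

definition lat_mult :: "'a set \<Rightarrow> 'a set \<Rightarrow> 'a set"
  where "lat_mult L1 L2 =
    {\<Sum>i<n. a i * b i | (n::nat) a b. \<forall>i<n. a i \<in> L1 \<and> b i \<in> L2}"

definition is_order :: "'a set \<Rightarrow> bool"
  where "is_order \<Lambda> \<longleftrightarrow> full_lattice \<Lambda> \<and> 1 \<in> \<Lambda> \<and> lat_mult \<Lambda> \<Lambda> \<subseteq> \<Lambda>"

definition order_of :: "'a set \<Rightarrow> 'a set"
  where "order_of L = {a. (\<lambda>x. a * x) ` L \<subseteq> L}"

definition w_equiv :: "('a set \<times> 'a set) set"
  where "w_equiv = {(L1, L2). full_lattice L1 \<and> full_lattice L2 \<and>
    (L1 = L2 \<or> (\<exists>X1 X2. full_lattice X1 \<and> full_lattice X2 \<and>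
      lat_mult L1 X1 = L2 \<and> lat_mult L2 X2 = L1))}"

text \<open>Since w-equivalent full lattices have the same order, the classes below are contained
  in the set of full lattices with order \<open>\<Lambda>\<close>. As always, \<open>card\<close> is \<open>0\<close> on infinite sets; a
  nonzero value of \<open>tau\<close> therefore includes that the number of classes is finite.\<close>

definition tau :: "'a set \<Rightarrow> nat"
  where "tau \<Lambda> = card ({L. full_lattice L \<and> order_of L = \<Lambda>} // w_equiv)"

end

end

theory Submission
  imports Defs
begin

text \<open>Every order \<open>\<Lambda>\<close> of rank three has a basis \<open>1, \<omega>, \<theta>\<close> with \<open>\<omega> * \<theta>\<close> an integer, and associativity
  then forces the multiplication table to be that of a binary cubic form \<open>(a, b, c, d)\<close>
  (Levi, Delone and Faddeev). If the form is nonzero, its content \<open>gcd a b c d\<close> is the number \<open>\<mu>\<close>.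

  For a lattice \<open>L\<close> with order \<open>\<Lambda>\<close> consider the trace ideal \<open>I(L) = L (\<Lambda> : L)\<close> of \<open>\<Lambda>\<close>. It depends
  only on the \<open>w\<close>-class of \<open>L\<close>, since \<open>I(M Y) \<subseteq> I(M)\<close>. Let \<open>T(L)\<close> be the set of primes \<open>p\<close> with
  \<open>I(L) \<inter> \<int> \<subseteq> p \<int>\<close>. The claim is that \<open>T\<close> separates the \<open>w\<close>-classes and that its values are
  precisely the sets of primes dividing the content; this gives \<open>2 ^ t\<close> classes.

  After a change of basis \<open>a \<noteq> 0\<close>. Let \<open>f\<close> be the coefficient of \<open>\<theta>\<close>. Then \<open>f (x * y)\<close> is a
  nondegenerate form on the algebra, so there is a duality \<open>L \<mapsto> L*\<close> on lattices with \<open>L** = L\<close>.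
  \<^item> \<^emph>\<open>Bound.\<close> If \<open>L\<close> has order \<open>\<Lambda>\<close> then \<open>L L* = \<Lambda>* = \<int> + \<int> \<omega>/a + \<int> \<theta>\<close>, hence
    \<open>\<Lambda>* (\<Lambda> : \<Lambda>*) \<subseteq> I(L)\<close>, and the left side visibly contains \<open>a, b, c, d\<close>
    (\<open>content_in_trace_ideal\<close>). So every prime in \<open>T(L)\<close> divides the content.
  \<^item> \<^emph>\<open>Separation.\<close> \<open>L\<close> and \<open>M\<close> are \<open>w\<close>-equivalent as soon as \<open>1 \<in> (M : L) (L : M)\<close> (\<open>w_equivI\<close>), and
    this product contains both \<open>I(L) I(M)\<close> and \<open>I(L*) I(M*)\<close>. If \<open>T(L) = T(M)\<close>, the first
    inclusion handles the primes outside \<open>T(L)\<close> and the second one those in \<open>T(L)\<close>, provided that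
    \<open>T(L)\<close> and \<open>T(L*)\<close> are disjoint (\<open>singular_primes_dual_disjoint\<close>).
  \<^item> \<^emph>\<open>Disjointness.\<close> For \<open>p\<close> dividing the content, all products of \<open>\<omega>\<close> and \<open>\<theta>\<close> vanish modulo \<open>p\<close>.
    The forms \<open>f (\<omega> l y)\<close> and \<open>f (\<theta> l y)\<close> on \<open>L \<times> L*\<close> are linearly independent modulo \<open>p\<close>, because
    a relation would put some \<open>(s \<omega> + t \<theta>) / p\<close> into the order of \<open>L\<close>. Two independent bilinear
    forms stay independent after a suitable element is inserted in one of the two slots
    (\<open>pencil_of_locally_dependent_forms\<close>). If that element is \<open>l \<in> L\<close>, Cramer's rule gives an integer
    \<open>\<Delta>\<close> prime to \<open>p\<close> with \<open>\<Delta> L \<subseteq> \<Lambda> l\<close>, so \<open>\<Delta> \<in> I(L)\<close> (\<open>generator_gives_coprime_trace\<close>); if it lies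
    in \<open>L*\<close>, the same holds for \<open>I(L*)\<close>.
  \<^item> \<^emph>\<open>Realisation.\<close> For a set \<open>T\<close> of primes dividing the content, let \<open>a1\<close> be the \<open>T\<close>-part of \<open>a\<close>;
    the lattice \<open>\<int> + \<int> \<omega>/a1 + \<int> \<theta>\<close>, which is \<open>\<Lambda>*\<close> at the primes in \<open>T\<close> and \<open>\<Lambda>\<close> elsewhere, has
    order \<open>\<Lambda>\<close> and invariant \<open>T\<close>.

  If the form is zero, then \<open>\<omega>\<close> and \<open>\<theta>\<close> span a square-zero ideal, every lattice with order \<open>\<Lambda>\<close> is a
  unit multiple of \<open>\<Lambda>\<close>, there is a single class, and \<open>\<mu> = 1\<close> will do.\<close>

section \<open>Bases of full lattices\<close>

interpretation Z: module "int_scale :: int \<Rightarrow> 'a::comm_ring_1 \<Rightarrow> 'a"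
  by (rule module_int_scale)

text \<open>As rewrite rules these module laws compete with \<open>of_int_mult\<close> and with the sign rules of rings.\<close>

declare Z.scale_scale [simp del] Z.scale_minus_left [simp del] Z.scale_minus_right [simp del]

lemma int_subgroup_cyclic:
  fixes G :: "int set"
  assumes "Z.subspace G"
  obtains g where "G = {n. g dvd n}"
proof (cases "G \<subseteq> {0}")
  case True
  then have "G = {n. 0 dvd n}"
    using Z.subspace_0[OF assms] by auto
  then show ?thesis by (rule that)
next
  case False
  then obtain x where "x \<in> G" "x \<noteq> 0" by auto
  then have ex: "\<bar>x\<bar> \<in> G \<and> \<bar>x\<bar> > 0"
    using Z.subspace_neg[OF assms, of x] by (auto simp: abs_if)
  define P where "P m \<longleftrightarrow> int m \<in> G \<and> m > 0" for m
  have "P (nat \<bar>x\<bar>)" using ex by (simp add: P_def)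
  define m where "m = (LEAST m. P m)"
  have m: "P m" unfolding m_def by (rule LeastI) fact
  have "int m dvd n" if "n \<in> G" for n
  proof (rule ccontr)
    assume nd: "\<not> int m dvd n"
    have mpos: "0 < int m" using m by (simp add: P_def)
    have "n mod int m = n - (n div int m) * int m" by (simp add: minus_div_mult_eq_mod)
    then have "n mod int m \<in> G"
      using m that Z.subspace_diff[OF assms that Z.subspace_scale[OF assms, of "int m" "n div int m"]]
      by (simp add: P_def)
    moreover have "0 < n mod int m" "n mod int m < int m"
      using nd mpos pos_mod_sign[OF mpos, of n] pos_mod_bound[OF mpos, of n]
      unfolding dvd_eq_mod_eq_0 by linarith+
    ultimately have "P (nat (n mod int m))" "nat (n mod int m) < m"
      unfolding P_def by (simp_all only: nat_0_le less_imp_le zero_less_nat_eq nat_less_iff)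
    then show False unfolding m_def using not_less_Least by blast
  qed
  moreover have "n \<in> G" if d: "int m dvd n" for n
  proof -
    obtain k where "n = int m * k" using d by (rule dvdE)
    then show ?thesis using m Z.subspace_scale[OF assms, of "int m" k]
      by (simp add: P_def mult.commute)
  qed
  ultimately have "G = {n. int m dvd n}" by blast
  then show ?thesis by (rule that)
qed

lemma proper_int_subgroup_in_prime_multiples:
  fixes G :: "int set"
  assumes G: "Z.subspace G" and "1 \<notin> G"
  obtains p :: nat where "prime p" "\<And>n. n \<in> G \<Longrightarrow> int p dvd n"
proof -
  obtain g where g: "G = {n. g dvd n}" using int_subgroup_cyclic[OF G] .
  then have "nat \<bar>g\<bar> \<noteq> 1" using assms(2) by (auto simp: zdvd1_eq)
  then obtain p where p: "prime p" "p dvd nat \<bar>g\<bar>"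
    using prime_factor_nat by blast
  then have "int p dvd g" by simp
  with p(1) show ?thesis using that g dvd_trans by blast
qed

context rat_algebra
begin

lemma of_int_mult_eq_scale: "of_int n * x = scale (of_int n) x"
proof -
  have nat: "of_nat k = scale (of_nat k) 1" for k
    by (induction k) (simp_all add: rat.scale_left_distrib)
  obtain i j where "n = int i - int j" by (rule int_diff_cases)
  then have "of_int n = scale (of_int n) 1"
    by (simp add: nat[of i] nat[of j] rat.scale_left_diff_distrib)
  then show ?thesis by (metis mult_1 scale_mult_left)
qed

lemma scale_mult_right: "x * scale r y = scale r (x * y)"
  by (metis mult.commute scale_mult_left)

lemma rat_subspace_imp_subgroup: "rat.subspace V \<Longrightarrow> Z.subspace V"
  unfolding rat.subspace_def Z.subspace_def by (simp add: of_int_mult_eq_scale)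

lemma int_span_subset_rat_span: "Z.span S \<subseteq> rat.span S"
  by (intro Z.span_minimal rat.span_superset rat_subspace_imp_subgroup rat.subspace_span)

lemma full_lattice_subgroup: "full_lattice L \<Longrightarrow> Z.subspace L"
  unfolding full_lattice_def by auto

lemma clear_denominator:
  assumes "x \<in> rat.span S"
  obtains n :: int where "n \<noteq> 0" "of_int n * x \<in> Z.span S"
proof -
  have "\<exists>n::int. n \<noteq> 0 \<and> of_int n * x \<in> Z.span S"
    using assms
  proof (induction rule: rat.span_induct_alt)
    case base
    then show ?case by (intro exI[of _ 1]) (simp add: Z.span_zero)
  next
    case (step c x y)
    then obtain n where n: "n \<noteq> 0" "of_int n * y \<in> Z.span S" by blast
    obtain u v where uv: "quotient_of c = (u, v)" by (cases "quotient_of c")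
    have v: "v > 0" "c = of_int u / of_int v"
      using quotient_of_denom_pos[OF uv] quotient_of_div[OF uv] by auto
    have "of_int (v * n) * (scale c x + y) = of_int (n * u) * x + of_int v * (of_int n * y)"
      unfolding of_int_mult_eq_scale
      by (simp only: rat.scale_right_distrib rat.scale_scale of_int_mult v(2)) (use v(1) in simp)
    moreover have "\<dots> \<in> Z.span S"
      by (intro Z.span_add Z.span_scale n Z.span_base step)
    ultimately show ?case using v n by (intro exI[of _ "v * n"]) simp
  qed
  then show ?thesis using that by blast
qed

lemma full_lattice_absorbs:
  assumes "full_lattice L"
  obtains n :: int where "n \<noteq> 0" "of_int n * x \<in> L"
proof -
  have "x \<in> rat.span L" using assms unfolding full_lattice_def by simp
  then obtain n :: int where "n \<noteq> 0" "of_int n * x \<in> Z.span L" by (rule clear_denominator)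
  moreover have "Z.span L = L" using full_lattice_subgroup[OF assms] by simp
  ultimately show ?thesis using that by simp
qed

lemma common_denominator:
  assumes "finite S" and M: "Z.subspace M"
    and "\<And>s. s \<in> S \<Longrightarrow> \<exists>n::int. n \<noteq> 0 \<and> of_int n * s \<in> M"
  obtains n :: int where "n \<noteq> 0" "\<And>x. x \<in> Z.span S \<Longrightarrow> of_int n * x \<in> M"
proof -
  have "\<exists>n::int. n \<noteq> 0 \<and> (\<forall>s\<in>S. of_int n * s \<in> M)"
    using assms(1,3)
  proof (induction S rule: finite_induct)
    case empty
    then show ?case by (intro exI[of _ 1]) simp
  next
    case (insert s S)
    obtain k :: int where k: "k \<noteq> 0" "\<forall>s\<in>S. of_int k * s \<in> M" using insert by auto
    obtain m :: int where m: "m \<noteq> 0" "of_int m * s \<in> M" using insert.prems by auto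
    have "of_int (m * k) * t \<in> M" if "t \<in> insert s S" for t
    proof (cases "t = s")
      case True
      then show ?thesis using Z.subspace_scale[OF M m(2), of k] by (simp add: ac_simps)
    next
      case False
      then have "of_int k * t \<in> M" using k that by auto
      then show ?thesis using Z.subspace_scale[OF M, of _ m] by (simp add: mult.assoc)
    qed
    then show ?case using k m by (intro exI[of _ "m * k"]) auto
  qed
  then obtain n :: int where n: "n \<noteq> 0" "\<forall>s\<in>S. of_int n * s \<in> M" by blast
  have "Z.subspace {x. of_int n * x \<in> M}"
    using M unfolding Z.subspace_def by (auto simp: distrib_left mult.left_commute)
  then have "Z.span S \<subseteq> {x. of_int n * x \<in> M}"
    by (rule Z.span_minimal[rotated]) (use n in auto)
  then show ?thesis using n that by blast
qed

text \<open>The finiteness in the definition of a full lattice enters here: one denominator serves all generators.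
  Boundedness of denominators is what replaces finite generation in the sequel, because unlike finite
  generation it passes to subgroups for trivial reasons.\<close>

lemma full_lattice_commensurable:
  assumes L: "full_lattice L" and M: "Z.subspace M"
    and absorbs: "\<And>x. \<exists>n::int. n \<noteq> 0 \<and> of_int n * x \<in> M"
  obtains n :: int where "n \<noteq> 0" "\<And>x. x \<in> L \<Longrightarrow> of_int n * x \<in> M"
proof -
  obtain S where S: "finite S" "L = Z.span S" using L unfolding full_lattice_def by blast
  show ?thesis by (rule common_denominator[OF S(1) M absorbs]) (use S(2) that in blast)
qed

lemma full_lattice_bounded_coordinates:
  assumes L: "full_lattice L" and B: "rat.span B = UNIV"
  obtains n :: int where "n \<noteq> 0" "\<And>x. x \<in> L \<Longrightarrow> of_int n * x \<in> Z.span B"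
proof (rule full_lattice_commensurable[OF L Z.subspace_span, of B])
  show "\<exists>n::int. n \<noteq> 0 \<and> of_int n * x \<in> Z.span B" for x
    using clear_denominator[of x B] B by auto
qed (rule that)

text \<open>One step of the Hermite normal form. The \<open>e\<close>-coordinates of elements of \<open>H\<close> form a subgroup of
  \<open>\<int>\<close>, which is cyclic; an element \<open>h\<close> whose coordinate generates it reduces every element of \<open>H\<close> to
  one without \<open>e\<close>.\<close>

lemma split_off_generator:
  assumes E: "e \<notin> E" "rat.independent (insert e E)"
    and H: "Z.subspace H" "H \<subseteq> Z.span (insert e E)"
  obtains h where "h \<in> H" "\<And>x. x \<in> H \<Longrightarrow> \<exists>k. x - of_int k * h \<in> H \<inter> Z.span E"
    "h \<in> rat.span E \<Longrightarrow> h = 0"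
proof -
  define I where "I = {n :: int. \<exists>x\<in>H. x - of_int n * e \<in> Z.span E}"
  have "Z.subspace I"
  proof (rule Z.subspaceI)
    show "0 \<in> I"
      unfolding I_def using Z.subspace_0[OF H(1)] by (auto intro!: bexI[of _ 0] Z.span_zero)
    show "m + n \<in> I" if mn: "m \<in> I" "n \<in> I" for m n
    proof -
      obtain x y where "x \<in> H" "y \<in> H" "x - of_int m * e \<in> Z.span E" "y - of_int n * e \<in> Z.span E"
        using mn unfolding I_def by blast
      then show ?thesis unfolding I_def
        using Z.span_add[of "x - of_int m * e" E "y - of_int n * e"]
        by (auto intro!: bexI[of _ "x + y"] Z.subspace_add[OF H(1)] simp: distrib_right add_diff_add)
    qed
    show "of_int m * n \<in> I" if n: "n \<in> I" for m n
    proof -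
      obtain x where "x \<in> H" "x - of_int n * e \<in> Z.span E" using n unfolding I_def by blast
      then show ?thesis unfolding I_def
        using Z.span_scale[of "x - of_int n * e" E m]
        by (auto intro!: bexI[of _ "of_int m * x"] Z.subspace_scale[OF H(1)]
            simp: right_diff_distrib mult.assoc)
    qed
  qed
  then obtain g where g: "I = {n. g dvd n}" by (rule int_subgroup_cyclic)
  then have "g \<in> I" by simp
  then obtain h0 where h0: "h0 \<in> H" "h0 - of_int g * e \<in> Z.span E"
    unfolding I_def by blast
  \<comment> \<open>If all coordinates vanish, \<open>h0\<close> could be any element of \<open>H\<close>; taking \<open>0\<close> keeps the last claim true.\<close>
  define h where "h = (if g = 0 then 0 else h0)"
  have h: "h \<in> H" "h - of_int g * e \<in> Z.span E"
    using h0 Z.subspace_0[OF H(1)] by (auto simp: h_def Z.span_zero)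
  show ?thesis
  proof (rule that)
    show "h \<in> H" by fact
    show "\<exists>k. x - of_int k * h \<in> H \<inter> Z.span E" if x: "x \<in> H" for x
    proof -
      have "x \<in> Z.span (insert e E)" using x H(2) by (rule subsetD[rotated])
      then obtain n where n: "x - of_int n * e \<in> Z.span E"
        by (auto simp: Z.span_breakdown_eq)
      with x have "n \<in> I" unfolding I_def by auto
      then obtain k where k: "n = g * k" using g by auto
      have "x - of_int k * h = (x - of_int n * e) - of_int k * (h - of_int g * e)"
        by (simp add: k algebra_simps)
      also have "\<dots> \<in> Z.span E" by (intro Z.span_diff n Z.span_scale h)
      finally show ?thesis
        using x h by (intro exI[of _ k]) (auto intro!: Z.subspace_diff[OF H(1)] Z.subspace_scale[OF H(1)])
    qed
    assume hE: "h \<in> rat.span E"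
    show "h = 0"
    proof (rule ccontr)
      assume "h \<noteq> 0"
      then have "g \<noteq> 0" by (auto simp: h_def)
      have "h - (h - of_int g * e) \<in> rat.span E"
        using hE h(2) int_span_subset_rat_span[of E] by (blast intro: rat.span_diff)
      then have "scale (of_int g) e \<in> rat.span E" by (simp add: of_int_mult_eq_scale)
      then have "e \<in> rat.span E"
        using rat.span_scale[of _ E "1 / of_int g"] \<open>g \<noteq> 0\<close> by fastforce
      then show False using E by (simp add: rat.independent_insert)
    qed
  qed
qed

lemma subgroup_basis:
  assumes "finite E" "rat.independent E" "Z.subspace H" "H \<subseteq> Z.span E"
  obtains B where "finite B" "rat.independent B" "Z.span B = H"
proof -
  have "\<exists>B. finite B \<and> rat.independent B \<and> Z.span B = H"
    using assms
  proof (induction E arbitrary: H rule: finite_induct)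
    case empty
    then have "H = {0}" using Z.subspace_0 by auto
    then show ?case by (intro exI[of _ "{}"]) (auto simp: rat.independent_empty)
  next
    case (insert e E)
    obtain h where h: "h \<in> H" "\<And>x. x \<in> H \<Longrightarrow> \<exists>k. x - of_int k * h \<in> H \<inter> Z.span E"
      "h \<in> rat.span E \<Longrightarrow> h = 0"
      using split_off_generator[OF insert.hyps(2) insert.prems] by blast
    have "rat.independent E" using insert.prems(1) insert.hyps(2) by (simp add: rat.independent_insert)
    then obtain B where B: "finite B" "rat.independent B" "Z.span B = H \<inter> Z.span E"
      using insert.IH[of "H \<inter> Z.span E"] insert.prems
      by (auto intro: Z.subspace_inter)
    have H: "Z.span (insert h B) = H"
    proof
      show "Z.span (insert h B) \<subseteq> H"
        using h(1) B(3) Z.span_superset[of B] insert.prems(2) by (intro Z.span_minimal) auto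
      show "H \<subseteq> Z.span (insert h B)"
        using h(2) B(3) by (auto simp: Z.span_breakdown_eq)
    qed
    show ?case
    proof (cases "h = 0")
      case True
      have "Z.span (insert h B) = Z.span B"
        using True Z.span_superset[of B] by (simp add: Z.span_eq Z.span_zero Z.span_base subset_iff)
      then show ?thesis using B H by auto
    next
      case False
      have "rat.span B \<subseteq> rat.span E"
        using B(3) Z.span_superset[of B] int_span_subset_rat_span[of E]
        by (intro rat.span_minimal rat.subspace_span) blast
      then have "rat.independent (insert h B)"
        using B False h(3) by (intro rat.independent_insertI) auto
      then show ?thesis using B H by (intro exI[of _ "insert h B"]) simp
    qed
  qed
  then show ?thesis using that by blast
qed

lemma subgroup_basis_scaled:
  assumes E: "finite E" "rat.independent E" and H: "Z.subspace H"
    and n: "n \<noteq> 0" "\<And>x. x \<in> H \<Longrightarrow> of_int n * x \<in> Z.span E"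
  obtains B where "finite B" "rat.independent B" "Z.span B = H"
proof -
  interpret dilation: Vector_Spaces.linear scale scale "scale (1 / of_int n)"
    by (rule rat.linear_scale_self)
  define E' where "E' = scale (1 / of_int n) ` E"
  have "rat.independent E'"
    unfolding E'_def using E(2) n(1) rat.injective_scale[of "1 / of_int n"]
    by (intro dilation.independent_injective_image) (auto intro: inj_on_subset)
  moreover have "H \<subseteq> Z.span E'"
  proof
    fix x assume "x \<in> H"
    have "Z.subspace {y. scale (1 / of_int n) y \<in> Z.span E'}"
      unfolding Z.subspace_def
      by (auto simp: rat.scale_right_distrib Z.span_zero Z.span_add scale_mult_right Z.span_scale
          simp flip: scale_mult_right)
    then have "Z.span E \<subseteq> {y. scale (1 / of_int n) y \<in> Z.span E'}"
      by (rule Z.span_minimal[rotated]) (auto simp: E'_def intro: Z.span_base)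
    then have "scale (1 / of_int n) (of_int n * x) \<in> Z.span E'"
      using n(2)[OF \<open>x \<in> H\<close>] by auto
    then show "x \<in> Z.span E'" using n(1) by (simp add: of_int_mult_eq_scale)
  qed
  ultimately show ?thesis
    using subgroup_basis[of E' H] E(1) H that unfolding E'_def by blast
qed

lemma full_lattice_basis:
  assumes "full_lattice L"
  obtains B where "finite B" "rat.independent B" "rat.span B = UNIV" "Z.span B = L"
proof -
  obtain S where S: "finite S" "L = Z.span S" using assms unfolding full_lattice_def by blast
  have "rat.span L = UNIV" using assms unfolding full_lattice_def by blast
  moreover have "rat.span L \<subseteq> rat.span S"
    using S int_span_subset_rat_span by (intro rat.span_minimal) auto
  ultimately have spanS: "rat.span S = UNIV" by auto
  obtain E where E: "E \<subseteq> S" "rat.independent E" "S \<subseteq> rat.span E"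
    using rat.maximal_independent_subset by blast
  have "rat.span E = UNIV" 
    using spanS E rat.span_minimal[OF E(3)] by auto
  have fE: "finite E" using E(1) S(1) finite_subset by blast
  obtain n :: int where n: "n \<noteq> 0" "\<And>x. x \<in> L \<Longrightarrow> of_int n * x \<in> Z.span E"
    using full_lattice_bounded_coordinates[OF assms \<open>rat.span E = UNIV\<close>] by blast
  obtain B where B: "finite B" "rat.independent B" "Z.span B = L"
    using subgroup_basis_scaled[OF fE E(2) full_lattice_subgroup[OF assms] n(1)] n(2) by blast
  have "rat.span L \<subseteq> rat.span B"
    using B int_span_subset_rat_span by (intro rat.span_minimal) auto
  then have "rat.span B = UNIV" using \<open>rat.span L = UNIV\<close> by auto
  then show ?thesis using B that by blast
qed

text \<open>Finite generation follows from bounded denominators, since a subgroup of a lattice has an integral basis.\<close>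

lemma full_latticeI:
  assumes L: "full_lattice L" and H: "Z.subspace H"
    and n: "n \<noteq> 0" "\<And>x. x \<in> H \<Longrightarrow> of_int n * x \<in> L"
    and absorbs: "\<And>x. \<exists>m::int. m \<noteq> 0 \<and> of_int m * x \<in> H"
  shows "full_lattice H"
proof -
  obtain E where E: "finite E" "rat.independent E" "Z.span E = L"
    using full_lattice_basis[OF L] by blast
  obtain B where "finite B" "Z.span B = H"
    using subgroup_basis_scaled[OF E(1,2) H n(1)] n(2) E(3) by blast
  moreover have "x \<in> rat.span H" for x
  proof -
    obtain m :: int where "m \<noteq> 0" "of_int m * x \<in> H" using absorbs by blast
    then have "scale (1 / of_int m) (scale (of_int m) x) \<in> rat.span H"
      by (intro rat.span_scale rat.span_base) (simp add: of_int_mult_eq_scale)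
    then show ?thesis using \<open>m \<noteq> 0\<close> by simp
  qed
  ultimately show ?thesis unfolding full_lattice_def by auto
qed

definition rat_linear_form :: "('a \<Rightarrow> rat) \<Rightarrow> bool"
  where "rat_linear_form g \<longleftrightarrow>
    (\<forall>x y. g (x + y) = g x + g y) \<and> (\<forall>r x. g (scale r x) = r * g x)"

text \<open>Some coordinate of \<open>x\<close> with respect to an integral basis of \<open>L\<close> is not an integer. This is the
  source of the equality of a lattice with its bidual.\<close>

lemma full_lattice_separation:
  assumes L: "full_lattice L" and x: "x \<notin> L"
  obtains g where "rat_linear_form g" "\<And>y. y \<in> L \<Longrightarrow> g y \<in> \<int>" "g x \<notin> \<int>"
proof -
  obtain B where B: "finite B" "rat.independent B" "rat.span B = UNIV" "Z.span B = L"
    using full_lattice_basis[OF L] .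
  define g where "g b y = rat.representation B y b" for b y
  have lin: "rat_linear_form (g b)" for b
    unfolding rat_linear_form_def g_def
    using B by (simp add: rat.representation_add rat.representation_scale)
  have int: "g b y \<in> \<int>" if "y \<in> L" for b y
  proof -
    have "Z.subspace {y. g b y \<in> \<int>}"
      using lin[of b] unfolding Z.subspace_def rat_linear_form_def
      by (auto simp: of_int_mult_eq_scale g_def rat.representation_zero)
    then have "Z.span B \<subseteq> {y. g b y \<in> \<int>}"
      by (rule Z.span_minimal[rotated])
        (auto simp: g_def rat.representation_basis[OF B(2)])
    then show ?thesis using that B(4) by auto
  qed
  have "\<exists>b\<in>B. g b x \<notin> \<int>"
  proof (rule ccontr)
    assume "\<not> ?thesis"
    then have gi: "g b x \<in> \<int>" if "b \<in> B" for b using that by auto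
    have "x = (\<Sum>b\<in>B. scale (g b x) b)"
      unfolding g_def using B by (simp add: rat.sum_representation_eq)
    also have "\<dots> \<in> Z.span B"
    proof (rule Z.span_sum)
      fix b assume b: "b \<in> B"
      obtain k where "g b x = of_int k" using gi[OF b] by (auto elim: Ints_cases)
      then show "scale (g b x) b \<in> Z.span B"
        using Z.span_scale[OF Z.span_base[OF b], of k] by (simp add: of_int_mult_eq_scale)
    qed
    finally show False using x B(4) by simp
  qed
  then show ?thesis using that lin int by blast
qed

end

section \<open>Products, colon lattices and weak equivalence\<close>

context rat_algebra
begin

definition colon :: "'a set \<Rightarrow> 'a set \<Rightarrow> 'a set"
  where "colon L M = {x. \<forall>y\<in>M. x * y \<in> L}"

text \<open>The sum of the images of all \<open>\<Lambda>\<close>-linear maps from \<open>L\<close> to \<open>\<Lambda>\<close>, if \<open>\<Lambda>\<close> is the order of \<open>L\<close>: such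
  maps are multiplications by elements of \<open>\<Lambda> : L\<close>. It is \<open>\<Lambda>\<close> iff \<open>L\<close> is invertible.\<close>

definition trace_ideal :: "'a set \<Rightarrow> 'a set \<Rightarrow> 'a set"
  where "trace_ideal \<Lambda> L = lat_mult L (colon \<Lambda> L)"

lemma colonD: "x \<in> colon L M \<Longrightarrow> y \<in> M \<Longrightarrow> x * y \<in> L"
  by (simp add: colon_def)

lemma colonD2: "x \<in> colon L M \<Longrightarrow> y \<in> M \<Longrightarrow> y * x \<in> L"
  by (subst mult.commute) (rule colonD)

lemma order_of_eq_colon: "order_of L = colon L L"
  unfolding order_of_def colon_def by auto

lemma colon_subgroup: "Z.subspace L \<Longrightarrow> Z.subspace (colon L M)"
  unfolding Z.subspace_def colon_def by (auto simp: distrib_right mult.assoc)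

lemma lat_mult_eq_span:
  assumes "Z.subspace X"
  shows "lat_mult X Y = Z.span {x * y | x y. x \<in> X \<and> y \<in> Y}" (is "_ = Z.span ?P")
proof
  show "lat_mult X Y \<subseteq> Z.span ?P"
    unfolding lat_mult_def by (auto intro!: Z.span_sum intro: Z.span_base)
  show "Z.span ?P \<subseteq> lat_mult X Y"
  proof
    fix z assume "z \<in> Z.span ?P"
    then show "z \<in> lat_mult X Y"
    proof (induction rule: Z.span_induct_alt)
      case base
      show ?case unfolding lat_mult_def by (intro CollectI exI[of _ 0]) simp
    next
      case (step k u z)
      obtain x y where u: "u = x * y" "x \<in> X" "y \<in> Y" using step.hyps by blast
      obtain n :: nat and a b where ab: "z = (\<Sum>i<n. a i * b i)" "\<forall>i<n. a i \<in> X \<and> b i \<in> Y"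
        using step.IH unfolding lat_mult_def by blast
      have kx: "of_int k * x \<in> X" using assms u(2) by (rule Z.subspace_scale)
      have "(\<Sum>i<Suc n. (a(n := of_int k * x)) i * (b(n := y)) i)
          = (\<Sum>i<n. a i * b i) + of_int k * x * y"
        by simp
      then have "of_int k * u + z = (\<Sum>i<Suc n. (a(n := of_int k * x)) i * (b(n := y)) i)"
        by (simp add: u(1) ab(1) mult.assoc)
      moreover have "\<forall>i<Suc n. (a(n := of_int k * x)) i \<in> X \<and> (b(n := y)) i \<in> Y"
        using ab(2) kx u(3) by (simp add: less_Suc_eq)
      ultimately show ?case unfolding lat_mult_def by blast
    qed
  qed
qed

lemma lat_mult_subgroup: "Z.subspace X \<Longrightarrow> Z.subspace (lat_mult X Y)"
  by (simp add: lat_mult_eq_span)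

lemma lat_multI: "x \<in> X \<Longrightarrow> y \<in> Y \<Longrightarrow> x * y \<in> lat_mult X Y"
  unfolding lat_mult_def
  by (intro CollectI exI[of _ "1::nat"] exI[of _ "\<lambda>_. x"] exI[of _ "\<lambda>_. y"]) simp

lemma lat_mult_least:
  assumes "Z.subspace H" "\<And>x y. x \<in> X \<Longrightarrow> y \<in> Y \<Longrightarrow> x * y \<in> H"
  shows "lat_mult X Y \<subseteq> H"
  unfolding lat_mult_def by (auto intro!: Z.subspace_sum[OF assms(1)] assms(2))

lemma multiplier_subgroup: "Z.subspace H \<Longrightarrow> Z.subspace {z. u * z \<in> H}"
  unfolding Z.subspace_def by (auto simp: distrib_left mult.left_commute[of u])

lemma lat_mult_pair_mem:
  assumes H: "Z.subspace H"
    and "\<And>x y x' y'. x \<in> X \<Longrightarrow> y \<in> Y \<Longrightarrow> x' \<in> X' \<Longrightarrow> y' \<in> Y' \<Longrightarrow> (x * y) * (x' * y') \<in> H"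
    and u: "u \<in> lat_mult X Y" and v: "v \<in> lat_mult X' Y'"
  shows "u * v \<in> H"
proof -
  have "lat_mult X' Y' \<subseteq> {z. (x * y) * z \<in> H}" if "x \<in> X" "y \<in> Y" for x y
    using that assms by (intro lat_mult_least multiplier_subgroup) auto
  then have "lat_mult X Y \<subseteq> {z. v * z \<in> H}"
    using v by (intro lat_mult_least multiplier_subgroup H) (auto simp: mult.commute[of v])
  with u show ?thesis by (auto simp: mult.commute)
qed

lemma colon_full_lattice:
  assumes L: "full_lattice L" and M: "full_lattice M"
  shows "full_lattice (colon L M)"
proof -
  obtain n :: int where n: "n \<noteq> 0" "of_int n * 1 \<in> M" using full_lattice_absorbs[OF M] .
  show ?thesis
  proof (rule full_latticeI[OF L colon_subgroup[OF full_lattice_subgroup[OF L]] n(1)])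
    show "of_int n * x \<in> L" if "x \<in> colon L M" for x
      using colonD[OF that n(2)] by (simp add: mult.commute)
    fix x
    have absorbs: "\<exists>k::int. k \<noteq> 0 \<and> of_int k * y \<in> {z. x * z \<in> L}" for y
    proof -
      obtain k :: int where "k \<noteq> 0" "of_int k * (x * y) \<in> L" using full_lattice_absorbs[OF L] .
      then show ?thesis by (auto simp: mult.left_commute)
    qed
    obtain m :: int where "m \<noteq> 0" "\<And>y. y \<in> M \<Longrightarrow> of_int m * y \<in> {z. x * z \<in> L}"
      using full_lattice_commensurable[OF M multiplier_subgroup[OF full_lattice_subgroup[OF L]] absorbs]
      by blast
    then show "\<exists>m::int. m \<noteq> 0 \<and> of_int m * x \<in> colon L M"
      by (intro exI[of _ m]) (auto simp: colon_def ac_simps)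
  qed
qed

text \<open>With \<open>X = M : L\<close> one has \<open>L X \<subseteq> M\<close>, and \<open>M = M \<cdot> 1 \<subseteq> M (L : M) (M : L) \<subseteq> L X\<close>.\<close>

lemma w_equivI:
  assumes L: "full_lattice L" and M: "full_lattice M"
    and 1: "1 \<in> lat_mult (colon M L) (colon L M)"
  shows "(L, M) \<in> w_equiv"
proof -
  have "lat_mult L' (colon M' L') = M'"
    if L': "full_lattice L'" and M': "full_lattice M'"
      and 1: "1 \<in> lat_mult (colon M' L') (colon L' M')" for L' M'
  proof
    note sub = full_lattice_subgroup[OF L'] full_lattice_subgroup[OF M']
    show "lat_mult L' (colon M' L') \<subseteq> M'"
      by (intro lat_mult_least sub) (rule colonD2)
    show "M' \<subseteq> lat_mult L' (colon M' L')"
    proof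
      fix m assume m: "m \<in> M'"
      have "lat_mult (colon M' L') (colon L' M') \<subseteq> {z. m * z \<in> lat_mult L' (colon M' L')}"
      proof (intro lat_mult_least multiplier_subgroup lat_mult_subgroup sub CollectI)
        fix x y assume "x \<in> colon M' L'" "y \<in> colon L' M'"
        then have "(m * y) * x \<in> lat_mult L' (colon M' L')"
          using m by (intro lat_multI) (auto intro: colonD2)
        then show "m * (x * y) \<in> lat_mult L' (colon M' L')" by (simp add: ac_simps)
      qed
      with 1 show "m \<in> lat_mult L' (colon M' L')" by auto
    qed
  qed
  note eq = this
  have "lat_mult (colon M L) (colon L M) \<subseteq> lat_mult (colon L M) (colon M L)"
    using L M
    by (intro lat_mult_least lat_mult_subgroup colon_subgroup full_lattice_subgroup)
      (assumption, subst mult.commute, rule lat_multI)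
  then have one': "1 \<in> lat_mult (colon L M) (colon M L)" using 1 by blast
  from eq[OF L M 1] eq[OF M L one'] show ?thesis
    unfolding w_equiv_def using L M colon_full_lattice by blast
qed

lemma w_equiv_cases:
  assumes "(L, M) \<in> w_equiv"
  obtains "L = M" | X Y where "lat_mult L X = M" "lat_mult M Y = L"
  using assms unfolding w_equiv_def by blast

lemma w_equiv_full_lattice:
  assumes "(L, M) \<in> w_equiv"
  shows "full_lattice L" "full_lattice M"
  using assms unfolding w_equiv_def by blast+

lemma order_of_subset_order_of_product:
  assumes L: "Z.subspace L"
  shows "order_of L \<subseteq> order_of (lat_mult L X)"
proof
  fix u assume u: "u \<in> order_of L"
  have "lat_mult L X \<subseteq> {z. u * z \<in> lat_mult L X}"
    using u by (intro lat_mult_least multiplier_subgroup lat_mult_subgroup L)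
      (auto simp: order_of_eq_colon colonD mult.assoc[symmetric] intro: lat_multI)
  then show "u \<in> order_of (lat_mult L X)" by (auto simp: order_of_eq_colon colon_def)
qed

lemma w_equiv_order_of:
  assumes "(L, M) \<in> w_equiv"
  shows "order_of L = order_of M"
  using assms
proof (cases rule: w_equiv_cases)
  case (2 X Y)
  with w_equiv_full_lattice[OF assms, THEN full_lattice_subgroup] show ?thesis
    using order_of_subset_order_of_product[of L X] order_of_subset_order_of_product[of M Y]
    by (simp add: subset_antisym)
qed simp

text \<open>If \<open>x\<close> maps \<open>M Y\<close> into \<open>\<Lambda>\<close>, then \<open>x * y\<close> maps \<open>M\<close> into \<open>\<Lambda>\<close> for all \<open>y \<in> Y\<close>. Two lattices that are
  multiples of each other therefore have the same trace ideal.\<close>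

lemma trace_ideal_product_subset:
  assumes M: "Z.subspace M"
  shows "trace_ideal \<Lambda> (lat_mult M Y) \<subseteq> trace_ideal \<Lambda> M"
  unfolding trace_ideal_def[of \<Lambda> "lat_mult M Y"]
proof (intro lat_mult_least)
  show sub: "Z.subspace (trace_ideal \<Lambda> M)"
    unfolding trace_ideal_def using M by (rule lat_mult_subgroup)
  fix l x assume l: "l \<in> lat_mult M Y" and x: "x \<in> colon \<Lambda> (lat_mult M Y)"
  have "lat_mult M Y \<subseteq> {z. x * z \<in> trace_ideal \<Lambda> M}"
  proof (intro lat_mult_least multiplier_subgroup sub CollectI)
    fix m y assume m: "m \<in> M" and y: "y \<in> Y"
    have "x * y \<in> colon \<Lambda> M"
      unfolding colon_def
    proof (intro CollectI ballI)
      fix n assume "n \<in> M"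
      then show "x * y * n \<in> \<Lambda>" using colonD[OF x lat_multI[OF _ y]] by (simp add: ac_simps)
    qed
    then have "m * (x * y) \<in> trace_ideal \<Lambda> M"
      unfolding trace_ideal_def using m by (intro lat_multI)
    then show "x * (m * y) \<in> trace_ideal \<Lambda> M" by (simp add: ac_simps)
  qed
  then show "l * x \<in> trace_ideal \<Lambda> M" using l by (auto simp: mult.commute)
qed

lemma trace_ideal_w_equiv:
  assumes "(L, M) \<in> w_equiv"
  shows "trace_ideal \<Lambda> L = trace_ideal \<Lambda> M"
  using assms
proof (cases rule: w_equiv_cases)
  case (2 X Y)
  with w_equiv_full_lattice[OF assms, THEN full_lattice_subgroup] show ?thesis
    using trace_ideal_product_subset[of L \<Lambda> X] trace_ideal_product_subset[of M \<Lambda> Y]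
    by (simp add: subset_antisym)
qed simp

lemma is_orderD:
  assumes "is_order \<Lambda>"
  shows "full_lattice \<Lambda>" "1 \<in> \<Lambda>" "\<And>x y. x \<in> \<Lambda> \<Longrightarrow> y \<in> \<Lambda> \<Longrightarrow> x * y \<in> \<Lambda>"
proof -
  show "full_lattice \<Lambda>" "1 \<in> \<Lambda>" using assms by (simp_all add: is_order_def)
  have "lat_mult \<Lambda> \<Lambda> \<subseteq> \<Lambda>" using assms by (simp add: is_order_def)
  then show "x * y \<in> \<Lambda>" if "x \<in> \<Lambda>" "y \<in> \<Lambda>" for x y
    using that by (rule subsetD[OF _ lat_multI])
qed

lemma order_of_order:
  assumes "is_order \<Lambda>"
  shows "order_of \<Lambda> = \<Lambda>"
proof
  show "\<Lambda> \<subseteq> order_of \<Lambda>"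
    using is_orderD(3)[OF assms] unfolding order_of_eq_colon colon_def by blast
  show "order_of \<Lambda> \<subseteq> \<Lambda>"
  proof
    fix x assume "x \<in> order_of \<Lambda>"
    then show "x \<in> \<Lambda>"
      using colonD[OF _ is_orderD(2)[OF assms], of x \<Lambda>] by (simp add: order_of_eq_colon)
  qed
qed

text \<open>Counting by a complete invariant. Transitivity of the relation comes from the invariant
  itself, since a \<open>w\<close>-class never leaves the set of lattices with a given order.\<close>

lemma tau_eq_card_invariant:
  fixes F :: "'a set \<Rightarrow> 'b"
  defines "S \<Lambda> \<equiv> {L. full_lattice L \<and> order_of L = \<Lambda>}"
  assumes F: "\<And>L M. L \<in> S \<Lambda> \<Longrightarrow> M \<in> S \<Lambda> \<Longrightarrow> (L, M) \<in> w_equiv \<longleftrightarrow> F L = F M"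
  shows "tau \<Lambda> = card (F ` S \<Lambda>)"
proof -
  define cl where "cl L = w_equiv `` {L}" for L
  have cl: "cl L = {M \<in> S \<Lambda>. F L = F M}" if L: "L \<in> S \<Lambda>" for L
  proof -
    have "M \<in> S \<Lambda>" if "(L, M) \<in> w_equiv" for M
      using that L w_equiv_full_lattice(2)[OF that] w_equiv_order_of[OF that]
      by (simp add: S_def)
    then show ?thesis using F[OF L] by (auto simp: cl_def)
  qed
  define h where "h C = {L \<in> S \<Lambda>. C = F L}" for C
  have "cl ` S \<Lambda> = h ` (F ` S \<Lambda>)" using cl by (auto simp: h_def image_image)
  moreover have "inj_on h (F ` S \<Lambda>)" by (rule inj_onI) (auto simp: h_def)
  ultimately have "card (cl ` S \<Lambda>) = card (F ` S \<Lambda>)" by (simp add: card_image)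
  moreover have "S \<Lambda> // w_equiv = cl ` S \<Lambda>" by (auto simp: quotient_def cl_def)
  ultimately show ?thesis unfolding tau_def S_def by simp
qed

end

section \<open>Pencils of bilinear forms\<close>

text \<open>Over the field with \<open>p\<close> elements: if the bilinear forms \<open>P\<close> and \<open>Q\<close> become proportional whenever
  either argument is fixed, then they are proportional. Normalise at a pair \<open>(l0, y0)\<close> with
  \<open>P l0 y0 \<noteq> 0\<close>: the combination \<open>N\<close> of \<open>P\<close> and \<open>Q\<close> that vanishes at \<open>(l0, y0)\<close> vanishes on the whole
  row of \<open>l0\<close> and the whole column of \<open>y0\<close>. If \<open>N m z \<noteq> 0\<close> for some \<open>(m, z)\<close>, proportionality for the
  first arguments \<open>m\<close> and \<open>l0 + m\<close> makes \<open>P m y0\<close> and \<open>P (l0 + m) y0\<close> vanish, hence also \<open>P l0 y0\<close>.\<close>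

lemma pencil_of_locally_dependent_forms:
  fixes P Q :: "'a::ab_semigroup_add \<Rightarrow> 'b \<Rightarrow> int" and p :: int
  assumes p: "prime p"
    and add: "\<And>l m. l \<in> L \<Longrightarrow> m \<in> L \<Longrightarrow> l + m \<in> L"
    and P_add: "\<And>l m y. l \<in> L \<Longrightarrow> m \<in> L \<Longrightarrow> y \<in> M \<Longrightarrow> P (l + m) y = P l y + P m y"
    and Q_add: "\<And>l m y. l \<in> L \<Longrightarrow> m \<in> L \<Longrightarrow> y \<in> M \<Longrightarrow> Q (l + m) y = Q l y + Q m y"
    and left: "\<And>l y z. l \<in> L \<Longrightarrow> y \<in> M \<Longrightarrow> z \<in> M \<Longrightarrow> p dvd P l y * Q l z - P l z * Q l y"
    and right: "\<And>l m y. l \<in> L \<Longrightarrow> m \<in> L \<Longrightarrow> y \<in> M \<Longrightarrow> p dvd P l y * Q m y - P m y * Q l y"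
  obtains s t where "\<not> (p dvd s \<and> p dvd t)"
    "\<And>l y. l \<in> L \<Longrightarrow> y \<in> M \<Longrightarrow> p dvd s * P l y + t * Q l y"
proof (cases "\<forall>l\<in>L. \<forall>y\<in>M. p dvd P l y")
  case True
  then show ?thesis using that[of 1 0] p by auto
next
  case False
  then obtain l0 y0 where l0: "l0 \<in> L" and y0: "y0 \<in> M" and nd: "\<not> p dvd P l0 y0" by blast
  define c where "c = P l0 y0"
  define t where "t = Q l0 y0"
  define N where "N l y = c * Q l y - t * P l y" for l y
  have c: "\<not> p dvd c" using nd by (simp add: c_def)
  have N_left: "p dvd P l y * N l z - P l z * N l y" if "l \<in> L" "y \<in> M" "z \<in> M" for l y z
  proof -
    have "P l y * N l z - P l z * N l y = c * (P l y * Q l z - P l z * Q l y)"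
      by (simp add: N_def algebra_simps)
    then show ?thesis using left[OF that] by simp
  qed
  have N_row: "p dvd N l0 z" if "z \<in> M" for z
    using left[OF l0 y0 that] by (simp add: N_def c_def t_def mult.commute)
  have N_col: "p dvd N m y0" if "m \<in> L" for m
    using right[OF l0 that y0] by (simp add: N_def c_def t_def mult.commute)
  have "p dvd N m z" if m: "m \<in> L" and z: "z \<in> M" for m z
  proof (rule ccontr)
    assume nN: "\<not> p dvd N m z"
    have key: "p dvd P l y0" if l: "l \<in> L" "\<not> p dvd N l z" for l
    proof -
      have "p dvd P l z * N l y0" using N_col[OF l(1)] by simp
      then have "p dvd P l y0 * N l z"
        using N_left[OF l(1) y0 z] dvd_diff_right_iff dvd_diffD by (metis diff_add_cancel dvd_add)
      then show ?thesis using l(2) p by (simp add: prime_dvd_mult_iff)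
    qed
    have "N (l0 + m) z = N l0 z + N m z"
      using P_add[OF l0 m z] Q_add[OF l0 m z] by (simp add: N_def algebra_simps)
    then have "\<not> p dvd N (l0 + m) z" using nN N_row[OF z] by (simp add: dvd_add_right_iff)
    then have "p dvd P (l0 + m) y0" using key add l0 m by blast
    moreover have "p dvd P m y0" using key m nN by blast
    ultimately have "p dvd c"
      using P_add[OF l0 m y0] by (simp add: c_def dvd_add_left_iff)
    then show False using c by simp
  qed
  then show ?thesis
    using that[of "- t" c] c by (auto simp: N_def)
qed

section \<open>Cubic orders in coordinates\<close>

context rat_algebra
begin

definition triple :: "'a \<Rightarrow> 'a \<Rightarrow> rat \<Rightarrow> rat \<Rightarrow> rat \<Rightarrow> 'a"
  where "triple \<omega> \<theta> r s t = scale r 1 + scale s \<omega> + scale t \<theta>"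

definition order_basis :: "'a set \<Rightarrow> 'a \<Rightarrow> 'a \<Rightarrow> bool"
  where "order_basis \<Lambda> \<omega> \<theta> \<longleftrightarrow>
    (\<forall>r s t. triple \<omega> \<theta> r s t = 0 \<longrightarrow> r = 0 \<and> s = 0 \<and> t = 0) \<and>
    (\<forall>x. \<exists>r s t. x = triple \<omega> \<theta> r s t) \<and>
    (\<forall>x. x \<in> \<Lambda> \<longleftrightarrow> (\<exists>i j k. x = triple \<omega> \<theta> (of_int i) (of_int j) (of_int k)))"

text \<open>The table attached to the binary cubic form \<open>(a, b, c, d)\<close>. Its constant terms are those that
  associativity forces once \<open>\<omega> * \<theta>\<close> is an integer.\<close>

definition mult_table :: "'a \<Rightarrow> 'a \<Rightarrow> int \<Rightarrow> int \<Rightarrow> int \<Rightarrow> int \<Rightarrow> bool"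
  where "mult_table \<omega> \<theta> a b c d \<longleftrightarrow>
    \<omega> * \<omega> = triple \<omega> \<theta> (of_int (- a * c)) (of_int b) (of_int (- a)) \<and>
    \<omega> * \<theta> = triple \<omega> \<theta> (of_int (- a * d)) 0 0 \<and>
    \<theta> * \<theta> = triple \<omega> \<theta> (of_int (- b * d)) (of_int d) (of_int (- c))"

lemma triple_add: "triple \<omega> \<theta> r s t + triple \<omega> \<theta> r' s' t' = triple \<omega> \<theta> (r + r') (s + s') (t + t')"
  by (simp add: triple_def rat.scale_left_distrib)

lemma triple_diff: "triple \<omega> \<theta> r s t - triple \<omega> \<theta> r' s' t' = triple \<omega> \<theta> (r - r') (s - s') (t - t')"
  by (simp add: triple_def rat.scale_left_diff_distrib)

lemma scale_triple: "scale q (triple \<omega> \<theta> r s t) = triple \<omega> \<theta> (q * r) (q * s) (q * t)"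
  by (simp add: triple_def rat.scale_right_distrib)

lemma order_basis_inject:
  assumes "order_basis \<Lambda> \<omega> \<theta>"
  shows "triple \<omega> \<theta> r s t = triple \<omega> \<theta> r' s' t' \<longleftrightarrow> r = r' \<and> s = s' \<and> t = t'"
proof
  assume "triple \<omega> \<theta> r s t = triple \<omega> \<theta> r' s' t'"
  then have "triple \<omega> \<theta> (r - r') (s - s') (t - t') = 0" by (simp flip: triple_diff)
  then have "r - r' = 0 \<and> s - s' = 0 \<and> t - t' = 0"
    using assms unfolding order_basis_def by blast
  then show "r = r' \<and> s = s' \<and> t = t'" by simp
qed simp

lemma triple_mult:
  assumes "mult_table \<omega> \<theta> a b c d"
  shows "triple \<omega> \<theta> x0 x1 x2 * triple \<omega> \<theta> y0 y1 y2 = triple \<omega> \<theta>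
    (x0 * y0 - of_int (a * c) * (x1 * y1) - of_int (a * d) * (x1 * y2 + x2 * y1) - of_int (b * d) * (x2 * y2))
    (x0 * y1 + x1 * y0 + of_int b * (x1 * y1) + of_int d * (x2 * y2))
    (x0 * y2 + x2 * y0 - of_int a * (x1 * y1) - of_int c * (x2 * y2))"
proof -
  have "triple \<omega> \<theta> x0 x1 x2 * triple \<omega> \<theta> y0 y1 y2
      = triple \<omega> \<theta> (x0 * y0) (x0 * y1 + x1 * y0) (x0 * y2 + x2 * y0) + scale (x1 * y1) (\<omega> * \<omega>)
        + scale (x1 * y2 + x2 * y1) (\<omega> * \<theta>) + scale (x2 * y2) (\<theta> * \<theta>)"
    by (simp add: triple_def distrib_left distrib_right scale_mult_left scale_mult_right
        rat.scale_left_distrib rat.scale_right_distrib ac_simps)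
  also have "\<dots> = triple \<omega> \<theta>
    (x0 * y0 - of_int (a * c) * (x1 * y1) - of_int (a * d) * (x1 * y2 + x2 * y1) - of_int (b * d) * (x2 * y2))
    (x0 * y1 + x1 * y0 + of_int b * (x1 * y1) + of_int d * (x2 * y2))
    (x0 * y2 + x2 * y0 - of_int a * (x1 * y1) - of_int c * (x2 * y2))"
    using assms unfolding mult_table_def by (simp add: scale_triple triple_add algebra_simps)
  finally show ?thesis .
qed

end

locale cubic_order = rat_algebra scale
  for scale :: "rat \<Rightarrow> 'a::comm_ring_1 \<Rightarrow> 'a" +
  fixes \<Lambda> :: "'a set" and \<omega> \<theta> :: 'a and a b c d :: int
  assumes order: "is_order \<Lambda>"
    and basis: "order_basis \<Lambda> \<omega> \<theta>"
    and table: "mult_table \<omega> \<theta> a b c d"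
begin

definition coords :: "'a \<Rightarrow> rat \<times> rat \<times> rat"
  where "coords x = (SOME (r, s, t). x = triple \<omega> \<theta> r s t)"

definition k0 :: "'a \<Rightarrow> rat" where "k0 x = fst (coords x)"
definition k1 :: "'a \<Rightarrow> rat" where "k1 x = fst (snd (coords x))"
definition k2 :: "'a \<Rightarrow> rat" where "k2 x = snd (snd (coords x))"

lemma triple_coords: "triple \<omega> \<theta> (k0 x) (k1 x) (k2 x) = x"
proof -
  obtain r s t where rst: "x = triple \<omega> \<theta> r s t" using basis unfolding order_basis_def by blast
  have "case coords x of (r, s, t) \<Rightarrow> x = triple \<omega> \<theta> r s t"
    unfolding coords_def by (rule someI[where x = "(r, s, t)"]) (simp add: rst)
  then show ?thesis by (simp add: k0_def k1_def k2_def split_beta)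
qed

lemmas triple_inject = order_basis_inject[OF basis]

lemma coords_triple [simp]:
  "k0 (triple \<omega> \<theta> r s t) = r" "k1 (triple \<omega> \<theta> r s t) = s" "k2 (triple \<omega> \<theta> r s t) = t"
  using triple_coords[of "triple \<omega> \<theta> r s t"] by (simp_all add: triple_inject)

lemma coords_add [simp]: "k0 (x + y) = k0 x + k0 y" "k1 (x + y) = k1 x + k1 y" "k2 (x + y) = k2 x + k2 y"
  by (metis triple_coords triple_add coords_triple)+

lemma coords_scale [simp]: "k0 (scale r x) = r * k0 x" "k1 (scale r x) = r * k1 x" "k2 (scale r x) = r * k2 x"
  by (metis triple_coords scale_triple coords_triple)+

lemma coords_diff [simp]: "k0 (x - y) = k0 x - k0 y" "k1 (x - y) = k1 x - k1 y" "k2 (x - y) = k2 x - k2 y"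
  by (metis triple_coords triple_diff coords_triple)+

lemma coords_mult:
  "k0 (x * y) = k0 x * k0 y - of_int (a * c) * (k1 x * k1 y)
    - of_int (a * d) * (k1 x * k2 y + k2 x * k1 y) - of_int (b * d) * (k2 x * k2 y)"
  "k1 (x * y) = k0 x * k1 y + k1 x * k0 y + of_int b * (k1 x * k1 y) + of_int d * (k2 x * k2 y)"
  "k2 (x * y) = k0 x * k2 y + k2 x * k0 y - of_int a * (k1 x * k1 y) - of_int c * (k2 x * k2 y)"
  by (subst (1 2) triple_coords[symmetric], subst triple_mult[OF table], simp)+

lemma triple_units: "triple \<omega> \<theta> 1 0 0 = 1" "triple \<omega> \<theta> 0 1 0 = \<omega>" "triple \<omega> \<theta> 0 0 1 = \<theta>"
  by (simp_all add: triple_def)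

lemma coords_basis [simp]:
  "k0 1 = 1" "k1 1 = 0" "k2 1 = 0" "k0 \<omega> = 0" "k1 \<omega> = 1" "k2 \<omega> = 0" "k0 \<theta> = 0" "k1 \<theta> = 0" "k2 \<theta> = 1"
  using coords_triple[of 1 0 0] coords_triple[of 0 1 0] coords_triple[of 0 0 1]
  by (simp_all only: triple_units)

lemma coords_of_int [simp]: "k0 (of_int n) = of_int n" "k1 (of_int n) = 0" "k2 (of_int n) = 0"
  using of_int_mult_eq_scale[of n 1] by (simp_all del: coords_scale add: coords_scale(1)[of _ 1] coords_scale(2)[of _ 1] coords_scale(3)[of _ 1])

lemma coords_of_int_mult [simp]:
  "k0 (of_int n * x) = of_int n * k0 x" "k1 (of_int n * x) = of_int n * k1 x"
  "k2 (of_int n * x) = of_int n * k2 x"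
  by (simp_all add: of_int_mult_eq_scale)

lemma coords_eq_iff: "x = y \<longleftrightarrow> k0 x = k0 y \<and> k1 x = k1 y \<and> k2 x = k2 y"
  by (metis triple_coords)

lemma coords_0 [simp]: "k0 0 = 0" "k1 0 = 0" "k2 0 = 0"
  using coords_of_int[of 0] by simp_all

lemma coords_minus [simp]: "k0 (- x) = - k0 x" "k1 (- x) = - k1 x" "k2 (- x) = - k2 x"
  using coords_diff[of 0 x] by simp_all

lemma mem_order_iff: "x \<in> \<Lambda> \<longleftrightarrow> k0 x \<in> \<int> \<and> k1 x \<in> \<int> \<and> k2 x \<in> \<int>"
proof
  assume "x \<in> \<Lambda>"
  then obtain i j k where "x = triple \<omega> \<theta> (of_int i) (of_int j) (of_int k)"
    using basis unfolding order_basis_def by blast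
  then show "k0 x \<in> \<int> \<and> k1 x \<in> \<int> \<and> k2 x \<in> \<int>" by simp
next
  assume "k0 x \<in> \<int> \<and> k1 x \<in> \<int> \<and> k2 x \<in> \<int>"
  then obtain i j k where "k0 x = of_int i" "k1 x = of_int j" "k2 x = of_int k"
    by (auto elim!: Ints_cases)
  then have "x = triple \<omega> \<theta> (of_int i) (of_int j) (of_int k)" by (metis triple_coords)
  then show "x \<in> \<Lambda>" using basis unfolding order_basis_def by blast
qed

text \<open>An injective linear endomorphism of a finite-dimensional space is surjective.\<close>

lemma nonzero_divisor_imp_unit:
  fixes l :: 'a
  assumes "\<And>x. x * l = 0 \<Longrightarrow> x = 0"
  obtains l' where "l * l' = 1"
proof -
  have "rat.independent {1, \<omega>, \<theta>}"
  proof (rule rat.independent_if_scalars_zero)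
    fix f x assume sum: "(\<Sum>x\<in>{1, \<omega>, \<theta>}. scale (f x) x) = 0" and x: "x \<in> {1, \<omega>, \<theta>}"
    have "(\<Sum>x\<in>{1, \<omega>, \<theta>}. scale (f x) x) = triple \<omega> \<theta> (f 1) (f \<omega>) (f \<theta>)"
      by (simp add: triple_def coords_eq_iff[of _ \<omega>] coords_eq_iff[of _ \<theta>] ac_simps)
    with sum basis have "f 1 = 0 \<and> f \<omega> = 0 \<and> f \<theta> = 0" unfolding order_basis_def by simp
    with x show "f x = 0" by auto
  qed simp
  moreover have "x \<in> rat.span {1, \<omega>, \<theta>}" for x
  proof -
    have "triple \<omega> \<theta> (k0 x) (k1 x) (k2 x) \<in> rat.span {1, \<omega>, \<theta>}"
      unfolding triple_def by (intro rat.span_add rat.span_scale rat.span_base) auto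
    then show ?thesis by (simp add: triple_coords)
  qed
  ultimately interpret finite_dimensional_vector_space scale "{1, \<omega>, \<theta>}"
    by unfold_locales auto
  have lin: "Vector_Spaces.linear scale scale (\<lambda>x. x * l)"
    by unfold_locales (simp_all add: distrib_right scale_mult_left)
  have "inj (\<lambda>x. x * l)"
  proof (rule injI)
    fix x y assume "x * l = y * l"
    then have "(x - y) * l = 0" by (simp add: left_diff_distrib)
    then show "x = y" using assms[of "x - y"] by simp
  qed
  with lin have "surj (\<lambda>x. x * l)" by (rule linear_inj_imp_surj)
  then obtain l' where "l' * l = 1" by (metis surjD)
  then show ?thesis using that by (simp add: mult.commute)
qed

text \<open>Duality is with respect to the coefficient of \<open>\<theta>\<close>. The trace form would be degenerate for algebras
  with nilpotent elements, whereas \<open>k2 (x * y)\<close> is nondegenerate whenever \<open>a \<noteq> 0\<close>.\<close>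

definition dual :: "'a set \<Rightarrow> 'a set"
  where "dual L = {y. \<forall>x\<in>L. k2 (x * y) \<in> \<int>}"

lemma dualD: "y \<in> dual L \<Longrightarrow> x \<in> L \<Longrightarrow> k2 (x * y) \<in> \<int>"
  by (simp add: dual_def)

lemma subset_bidual: "L \<subseteq> dual (dual L)"
  unfolding dual_def by (auto simp: mult.commute)

definition proper_lattices :: "'a set set"
  where "proper_lattices = {L. full_lattice L \<and> order_of L = \<Lambda>}"

lemma proper_latticesD:
  assumes "L \<in> proper_lattices"
  shows "full_lattice L" "Z.subspace L" "\<And>u l. u \<in> \<Lambda> \<Longrightarrow> l \<in> L \<Longrightarrow> u * l \<in> L"
    "\<And>u. (\<And>l. l \<in> L \<Longrightarrow> u * l \<in> L) \<Longrightarrow> u \<in> \<Lambda>"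
proof -
  show full: "full_lattice L" using assms by (simp add: proper_lattices_def)
  show "Z.subspace L" using full by (rule full_lattice_subgroup)
  have \<Lambda>: "\<Lambda> = colon L L" using assms by (simp add: proper_lattices_def order_of_eq_colon)
  show "u * l \<in> L" if "u \<in> \<Lambda>" "l \<in> L" for u l using that by (simp add: \<Lambda> colonD)
  show "u \<in> \<Lambda>" if "\<And>l. l \<in> L \<Longrightarrow> u * l \<in> L" for u using that by (simp add: \<Lambda> colon_def)
qed

lemma basis_in_order: "1 \<in> \<Lambda>" "\<omega> \<in> \<Lambda>" "\<theta> \<in> \<Lambda>"
  by (simp_all add: mem_order_iff)

lemma dual_module:
  assumes "L \<in> proper_lattices" "u \<in> \<Lambda>" "y \<in> dual L"
  shows "u * y \<in> dual L"
proof -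
  have "k2 (x * (u * y)) \<in> \<int>" if "x \<in> L" for x
    using dualD[OF assms(3) proper_latticesD(3)[OF assms(1,2) that]] by (simp add: ac_simps)
  then show ?thesis by (simp add: dual_def)
qed

text \<open>How the rows of the matrix in Cramer's rule below arise: \<open>v\<close> is one of the vectors \<open>l * y\<close>, \<open>l * z\<close>,
  \<open>\<omega> * (l * y)\<close>.\<close>

lemma k2_mult_expand:
  "k2 (t * v) = k0 t * k2 v + k1 t * k2 (\<omega> * v) + k2 t * k2 (\<theta> * v)"
  "k2 (\<omega> * (\<omega> * v)) = of_int b * k2 (\<omega> * v) - of_int (a * c) * k2 v - of_int a * k2 (\<theta> * v)"
  "k2 (\<theta> * (\<omega> * v)) = - of_int (a * d) * k2 v"
  by (simp_all add: coords_mult algebra_simps)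

text \<open>The element \<open>l\<close> generates \<open>L\<close> locally at \<open>p\<close>. To see this, pair \<open>l, \<omega> l, \<theta> l\<close> with \<open>\<omega> y, y, z\<close>. As
  \<open>\<omega> \<omega>\<close> and \<open>\<theta> \<omega>\<close> vanish modulo \<open>p\<close>, the first row of the resulting matrix is \<open>(A, 0, 0)\<close> modulo \<open>p\<close>, and
  the determinant \<open>\<Delta>\<close> is \<open>A (A I - F H)\<close> modulo \<open>p\<close>, which is not zero. Hence \<open>l\<close> is a unit of the algebra,
  and for \<open>m \<in> L\<close> the coordinates of \<open>m / l\<close> solve a linear system with integer entries and
  determinant \<open>\<Delta>\<close>. So \<open>\<Delta> / l\<close> maps \<open>L\<close> into \<open>\<Lambda>\<close>.\<close>

lemma generator_gives_coprime_trace: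
  fixes p :: nat
  assumes p: "prime p" and dvd: "int p dvd a" "int p dvd b"
    and L: "\<And>u l. u \<in> \<Lambda> \<Longrightarrow> l \<in> L \<Longrightarrow> u * l \<in> L"
    and M: "\<And>l y. l \<in> L \<Longrightarrow> y \<in> M \<Longrightarrow> k2 (l * y) \<in> \<int>"
    and l: "l \<in> L" and y: "y \<in> M" and z: "z \<in> M"
    and ints: "of_int A = k2 (\<omega> * (l * y))" "of_int F = k2 (\<theta> * (l * y))"
      "of_int H = k2 (\<omega> * (l * z))" "of_int I = k2 (\<theta> * (l * z))"
    and nd: "\<not> int p dvd A" "\<not> int p dvd A * I - F * H"
  obtains n where "of_int n \<in> trace_ideal \<Lambda> L" "\<not> int p dvd n"
proof -
  obtain E G where EG: "of_int E = k2 (l * y)" "of_int G = k2 (l * z)"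
    using M[OF l y] M[OF l z] by (auto elim!: Ints_cases)
  define B C where "B = b * A - a * c * E - a * F" and "C = - a * d * E"
  define \<Delta> where "\<Delta> = A * (A * I - F * H) - B * (E * I - F * G) + C * (E * H - A * G)"
  have pair: "k2 (t * (l * y)) = k0 t * of_int E + k1 t * of_int A + k2 t * of_int F"
    "k2 (t * (l * z)) = k0 t * of_int G + k1 t * of_int H + k2 t * of_int I"
    "k2 (t * (\<omega> * (l * y))) = k0 t * of_int A + k1 t * of_int B + k2 t * of_int C" for t
    using k2_mult_expand(1)[of t "l * y"] k2_mult_expand(1)[of t "l * z"]
      k2_mult_expand(1)[of t "\<omega> * (l * y)"]
    unfolding k2_mult_expand(2,3) B_def C_def by (simp_all flip: ints EG)
  \<comment> \<open>The coefficients are the entries of the adjugate of the matrix in \<open>pair\<close>.\<close>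
  have cramer: "of_int \<Delta> * k0 t = k2 (t * (\<omega> * (l * y))) * of_int (A * I - F * H)
      - k2 (t * (l * y)) * of_int (B * I - C * H) + k2 (t * (l * z)) * of_int (B * F - C * A)"
    "of_int \<Delta> * k1 t = - k2 (t * (\<omega> * (l * y))) * of_int (E * I - F * G)
      + k2 (t * (l * y)) * of_int (A * I - C * G) - k2 (t * (l * z)) * of_int (A * F - C * E)"
    "of_int \<Delta> * k2 t = k2 (t * (\<omega> * (l * y))) * of_int (E * H - A * G)
      - k2 (t * (l * y)) * of_int (A * H - B * G) + k2 (t * (l * z)) * of_int (A * A - B * E)" for t
    unfolding pair \<Delta>_def by (simp_all add: algebra_simps)
  have "int p dvd B" "int p dvd C" using dvd by (auto simp: B_def C_def)
  moreover have "\<not> int p dvd A * (A * I - F * H)"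
    using nd p by (simp add: prime_dvd_mult_iff)
  ultimately have p\<Delta>: "\<not> int p dvd \<Delta>"
    unfolding \<Delta>_def by (simp add: dvd_add_left_iff dvd_diff_left_iff)
  then have "\<Delta> \<noteq> 0" by auto
  have "x = 0" if "x * l = 0" for x
  proof -
    have xl: "x * (l * v) = 0" for v using that by (simp flip: mult.assoc)
    have "k2 (x * (l * y)) = 0" "k2 (x * (l * z)) = 0" "k2 (x * (\<omega> * (l * y))) = 0"
      using xl[of y] xl[of z] xl[of "\<omega> * y"] by (simp_all add: mult.left_commute[of \<omega>])
    then show ?thesis using cramer[of x] \<open>\<Delta> \<noteq> 0\<close> by (simp add: coords_eq_iff)
  qed
  then obtain l' where l': "l * l' = 1" by (rule nonzero_divisor_imp_unit)
  have "of_int \<Delta> * l' \<in> colon \<Lambda> L"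
    unfolding colon_def
  proof (intro CollectI ballI)
    fix m assume m: "m \<in> L"
    define t where "t = l' * m"
    have tl: "t * (l * v) = m * v" for v
    proof -
      have "t * (l * v) = (l * l') * (m * v)" by (simp only: t_def ac_simps)
      then show ?thesis using l' by simp
    qed
    have "k2 (t * (l * y)) \<in> \<int>" "k2 (t * (l * z)) \<in> \<int>"
      unfolding tl by (rule M[OF m y] M[OF m z])+
    moreover have "t * (\<omega> * (l * y)) = (\<omega> * m) * y"
      using tl[of "\<omega> * y"] by (simp only: ac_simps)
    then have "k2 (t * (\<omega> * (l * y))) \<in> \<int>"
      using M[OF L[OF basis_in_order(2) m] y] by simp
    ultimately have "of_int \<Delta> * t \<in> \<Lambda>"
      unfolding mem_order_iff coords_of_int_mult cramer by (intro conjI) auto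
    then show "of_int \<Delta> * l' * m \<in> \<Lambda>" by (simp add: t_def mult.assoc)
  qed
  then have "l * (of_int \<Delta> * l') \<in> trace_ideal \<Lambda> L"
    unfolding trace_ideal_def by (rule lat_multI[OF l])
  then have "of_int \<Delta> \<in> trace_ideal \<Lambda> L" using l' by (simp add: mult.left_commute[of l])
  then show ?thesis using that p\<Delta> by blast
qed

end

section \<open>Classification by singular primes\<close>

text \<open>The prime factorization of \<open>a\<close> is split into the primes in \<open>T\<close>, with their full multiplicities, and
  the others.\<close>

lemma coprime_part_factorization:
  fixes a :: int and T :: "nat set"
  assumes a: "a \<noteq> 0" and T: "\<And>p. p \<in> T \<Longrightarrow> prime p \<and> int p dvd a"
  obtains a1 a2 where "a = a1 * a2" "coprime a1 a2"
    "\<And>p. prime p \<Longrightarrow> int p dvd a1 \<longleftrightarrow> p \<in> T"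
proof -
  define n where "n = nat \<bar>a\<bar>"
  have n: "n \<noteq> 0" using a by (simp add: n_def)
  define M1 where "M1 = filter_mset (\<lambda>p. p \<in> T) (prime_factorization n)"
  define M2 where "M2 = filter_mset (\<lambda>p. p \<notin> T) (prime_factorization n)"
  define n1 n2 where "n1 = prod_mset M1" and "n2 = prod_mset M2"
  have pr: "\<And>p. p \<in># M1 \<Longrightarrow> prime p" "\<And>p. p \<in># M2 \<Longrightarrow> prime p"
    by (auto simp: M1_def M2_def in_prime_factors_imp_prime)
  have "prime_factorization n = M1 + M2"
    unfolding M1_def M2_def by (rule multiset_partition)
  then have n12: "n = n1 * n2"
    using n prod_mset_prime_factorization_nat[of n] by (simp add: n1_def n2_def)
  have dvd1: "p dvd n1 \<longleftrightarrow> p \<in> T" if "prime p" for p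
  proof -
    have "p dvd n1 \<longleftrightarrow> p \<in># M1"
      unfolding n1_def using pr(1) that by (simp add: prime_dvd_prod_mset_primes_iff)
    also have "\<dots> \<longleftrightarrow> p \<in> T"
      using T[of p] n by (auto simp: M1_def n_def in_prime_factors_iff)
    finally show ?thesis .
  qed
  have dvd2: "p \<notin> T" if "prime p" "p dvd n2" for p
  proof -
    have "p \<in># M2"
      using that pr(2) unfolding n2_def by (simp add: prime_dvd_prod_mset_primes_iff)
    then show ?thesis by (simp add: M2_def)
  qed
  have cop: "coprime n1 n2"
  proof (rule ccontr)
    assume "\<not> coprime n1 n2"
    then have "gcd n1 n2 \<noteq> 1" by (simp add: coprime_iff_gcd_eq_1)
    then obtain p where "prime p" "p dvd gcd n1 n2" using prime_factor_nat by blast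
    then show False using dvd1 dvd2 by auto
  qed
  have "int n1 * int n2 = \<bar>a\<bar>" by (simp add: n_def flip: n12 of_nat_mult)
  then have "a = int n1 * (sgn a * int n2)" by (simp add: mult.left_commute sgn_mult_abs)
  moreover have "coprime (int n1) (sgn a * int n2)"
    using cop a by (simp add: sgn_if)
  ultimately show ?thesis using that dvd1 by simp
qed

context cubic_order
begin

text \<open>The primes \<open>p\<close> at which the localisation of the trace ideal is proper: for a full lattice the ideal contains a
  nonzero integer, so this happens iff all integers in it are divisible by \<open>p\<close>.\<close>

definition singular_primes :: "'a set \<Rightarrow> nat set"
  where "singular_primes L =
    {p. prime p \<and> (\<forall>n. of_int n \<in> trace_ideal \<Lambda> L \<longrightarrow> int p dvd n)}"

lemma singular_primes_w_equiv:
  "(L, M) \<in> w_equiv \<Longrightarrow> singular_primes L = singular_primes M"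
  unfolding singular_primes_def using trace_ideal_w_equiv[of L M \<Lambda>] by simp

text \<open>For \<open>l \<in> L\<close> and \<open>x \<in> \<Lambda> : M\<close> the product \<open>l * x\<close> maps \<open>M\<close> to \<open>\<Lambda> l \<subseteq> L\<close>; a product of two products
  is regrouped accordingly.\<close>

lemma trace_ideals_mult:
  assumes L: "L \<in> proper_lattices" and M: "M \<in> proper_lattices"
    and m: "of_int m \<in> trace_ideal \<Lambda> L" and n: "of_int n \<in> trace_ideal \<Lambda> M"
  shows "of_int (m * n) \<in> lat_mult (colon M L) (colon L M)"
proof -
  have sub: "Z.subspace (lat_mult (colon M L) (colon L M))"
    by (intro lat_mult_subgroup colon_subgroup proper_latticesD(2)[OF M])
  have "of_int m * of_int n \<in> lat_mult (colon M L) (colon L M)"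
  proof (rule lat_mult_pair_mem[OF sub _ m[unfolded trace_ideal_def] n[unfolded trace_ideal_def]])
    fix l x l' x' assume lx: "l \<in> L" "x \<in> colon \<Lambda> L" "l' \<in> M" "x' \<in> colon \<Lambda> M"
    have "l' * x \<in> colon M L" unfolding colon_def
    proof (intro CollectI ballI)
      fix k assume "k \<in> L"
      then show "l' * x * k \<in> M"
        using proper_latticesD(3)[OF M colonD[OF lx(2)] lx(3)] by (simp add: ac_simps)
    qed
    moreover have "l * x' \<in> colon L M" unfolding colon_def
    proof (intro CollectI ballI)
      fix k assume "k \<in> M"
      then show "l * x' * k \<in> L"
        using proper_latticesD(3)[OF L colonD[OF lx(4)] lx(1)] by (simp add: ac_simps)
    qed
    ultimately show "(l * x) * (l' * x') \<in> lat_mult (colon M L) (colon L M)"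
      using lat_multI[of "l' * x" "colon M L" "l * x'" "colon L M"] by (simp add: ac_simps)
  qed
  then show ?thesis by simp
qed

end

locale nondegenerate_cubic_order = cubic_order +
  assumes a_nz: "a \<noteq> 0"
begin

lemma dual_subgroup: "Z.subspace (dual L)"
  unfolding Z.subspace_def dual_def by (auto simp: distrib_left mult.left_commute[of _ "of_int _"])

text \<open>Comparing the values at \<open>1\<close>, \<open>\<omega>\<close> and \<open>\<theta>\<close> determines \<open>y\<close>; only the \<open>\<omega>\<close>-coordinate needs a division.\<close>

lemma form_representation:
  assumes g: "rat_linear_form g"
  obtains y where "\<And>x. g x = k2 (x * y)"
proof -
  define y where "y = triple \<omega> \<theta> (g \<theta> + of_int c * g 1) (- g \<omega> / of_int a) (g 1)"
  have "g x = k2 (x * y)" for x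
  proof -
    have "g x = g (triple \<omega> \<theta> (k0 x) (k1 x) (k2 x))" by (simp add: triple_coords)
    also have "\<dots> = k0 x * g 1 + k1 x * g \<omega> + k2 x * g \<theta>"
      using g unfolding triple_def rat_linear_form_def by simp
    also have "\<dots> = k2 (x * y)"
      using a_nz by (simp add: y_def coords_mult algebra_simps)
    finally show ?thesis .
  qed
  then show ?thesis by (rule that)
qed

lemma bidual:
  assumes L: "full_lattice L"
  shows "dual (dual L) = L"
proof
  show "dual (dual L) \<subseteq> L"
  proof (rule subsetI, rule ccontr)
    fix x assume x: "x \<in> dual (dual L)" "x \<notin> L"
    obtain g where g: "rat_linear_form g" "\<And>y. y \<in> L \<Longrightarrow> g y \<in> \<int>" "g x \<notin> \<int>"
      using full_lattice_separation[OF L x(2)] by blast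
    obtain y where y: "\<And>x. g x = k2 (x * y)" using form_representation[OF g(1)] by blast
    have "y \<in> dual L" using g(2) y by (simp add: dual_def)
    then have "k2 (y * x) \<in> \<int>" using dualD[OF x(1)] by simp
    then show False using g(3) y[of x] by (simp add: mult.commute)
  qed
qed (rule subset_bidual)

lemma mem_dual_order_iff: "z \<in> dual \<Lambda> \<longleftrightarrow> k0 z \<in> \<int> \<and> of_int a * k1 z \<in> \<int> \<and> k2 z \<in> \<int>"
proof
  assume "z \<in> dual \<Lambda>"
  from this[THEN dualD] have *: "k2 (1 * z) \<in> \<int>" "k2 (\<omega> * z) \<in> \<int>" "k2 (\<theta> * z) \<in> \<int>"
    using basis_in_order by blast+
  have "k0 z = k2 (\<theta> * z) + of_int c * k2 (1 * z)" "of_int a * k1 z = - k2 (\<omega> * z)"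
    by (simp_all add: coords_mult)
  with * show "k0 z \<in> \<int> \<and> of_int a * k1 z \<in> \<int> \<and> k2 z \<in> \<int>" by auto
next
  assume z: "k0 z \<in> \<int> \<and> of_int a * k1 z \<in> \<int> \<and> k2 z \<in> \<int>"
  have "k2 (x * z) \<in> \<int>" if "x \<in> \<Lambda>" for x
  proof -
    have "k2 (x * z) = k0 x * k2 z + k2 x * k0 z - k1 x * (of_int a * k1 z) - of_int c * (k2 x * k2 z)"
      by (simp add: coords_mult)
    with that z show ?thesis by (simp add: mem_order_iff)
  qed
  then show "z \<in> dual \<Lambda>" by (simp add: dual_def)
qed

text \<open>The dual of \<open>L L*\<close> consists of the \<open>x\<close> with \<open>x L \<subseteq> L** = L\<close>, that is, of the order of \<open>L\<close>. Dualising
  once more gives the claim.\<close>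

lemma lattice_mult_dual:
  assumes L: "L \<in> proper_lattices"
  shows "lat_mult L (dual L) = dual \<Lambda>"
proof
  note sub = proper_latticesD(2)[OF L]
  have "k2 (u * (l * y)) \<in> \<int>" if "u \<in> \<Lambda>" "l \<in> L" "y \<in> dual L" for u l y
    using dualD[OF that(3) proper_latticesD(3)[OF L that(1,2)]] by (simp add: mult.assoc)
  then show subD: "lat_mult L (dual L) \<subseteq> dual \<Lambda>"
    by (intro lat_mult_least dual_subgroup) (auto simp: dual_def)
  have full: "full_lattice (lat_mult L (dual L))"
  proof (rule full_latticeI[OF is_orderD(1)[OF order] lat_mult_subgroup[OF sub] a_nz])
    show "of_int a * x \<in> \<Lambda>" if "x \<in> lat_mult L (dual L)" for x
      using that subD mem_dual_order_iff[of x] by (auto simp: mem_order_iff)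
    fix x
    obtain n :: int where n: "n \<noteq> 0" "of_int n * 1 \<in> L"
      using full_lattice_absorbs[OF proper_latticesD(1)[OF L]] .
    obtain m :: int where m: "m \<noteq> 0" "of_int m * x \<in> colon \<Lambda> L"
      using full_lattice_absorbs[OF colon_full_lattice[OF is_orderD(1)[OF order] proper_latticesD(1)[OF L]]] .
    have "of_int m * x \<in> dual L"
      using colonD2[OF m(2)] by (auto simp: dual_def mem_order_iff)
    from lat_multI[OF n(2) this] n m
    show "\<exists>k::int. k \<noteq> 0 \<and> of_int k * x \<in> lat_mult L (dual L)"
      by (intro exI[of _ "n * m"]) (simp add: mult.assoc)
  qed
  have "dual (lat_mult L (dual L)) \<subseteq> \<Lambda>"
  proof
    fix x assume x: "x \<in> dual (lat_mult L (dual L))"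
    have "x * l \<in> dual (dual L)" if l: "l \<in> L" for l
    proof -
      have "k2 (y * (x * l)) \<in> \<int>" if "y \<in> dual L" for y
        using dualD[OF x lat_multI[OF l that]] by (simp add: ac_simps)
      then show ?thesis by (simp add: dual_def)
    qed
    then show "x \<in> \<Lambda>" using proper_latticesD(4)[OF L] bidual[OF proper_latticesD(1)[OF L]] by simp
  qed
  then have "dual \<Lambda> \<subseteq> dual (dual (lat_mult L (dual L)))" unfolding dual_def by blast
  then show "dual \<Lambda> \<subseteq> lat_mult L (dual L)" by (simp add: bidual[OF full])
qed

lemma colon_dual_order_mult_subset_trace:
  assumes L: "L \<in> proper_lattices" and x: "x \<in> colon \<Lambda> (dual \<Lambda>)" and z: "z \<in> dual \<Lambda>"
  shows "x * z \<in> trace_ideal \<Lambda> L"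
proof -
  note sub = proper_latticesD(2)[OF L]
  have "lat_mult L (dual L) \<subseteq> {z. x * z \<in> trace_ideal \<Lambda> L}"
    unfolding trace_ideal_def
  proof (intro lat_mult_least multiplier_subgroup lat_mult_subgroup sub CollectI)
    fix l y assume l: "l \<in> L" and y: "y \<in> dual L"
    have "x * y \<in> colon \<Lambda> L"
      unfolding colon_def
    proof (intro CollectI ballI)
      fix m assume "m \<in> L"
      then have "m * y \<in> dual \<Lambda>" using lat_multI[OF _ y] lattice_mult_dual[OF L] by blast
      then show "x * y * m \<in> \<Lambda>" using colonD[OF x, of "m * y"] by (simp add: ac_simps)
    qed
    then show "x * (l * y) \<in> lat_mult L (colon \<Lambda> L)"
      using lat_multI[OF l, of "x * y"] by (simp add: mult.left_commute)
  qed
  then show ?thesis using z lattice_mult_dual[OF L] by blast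
qed

text \<open>The lattice \<open>\<Lambda>* = \<int> + \<int> \<eta> + \<int> \<theta>\<close> with \<open>\<eta> = \<omega> / a\<close> is multiplied into \<open>\<Lambda>\<close> by \<open>a\<close>, \<open>\<theta>\<close> and
  \<open>\<beta> = \<omega> - b\<close>. The coefficients of the form occur among the resulting products:
  \<open>b = a \<eta> - \<beta>\<close>, \<open>c = - \<beta> \<eta> - \<theta>\<close> and \<open>d = - \<theta> \<eta>\<close>.\<close>

lemma content_in_trace_ideal:
  assumes L: "L \<in> proper_lattices"
  shows "of_int a \<in> trace_ideal \<Lambda> L" "of_int b \<in> trace_ideal \<Lambda> L"
    "of_int c \<in> trace_ideal \<Lambda> L" "of_int d \<in> trace_ideal \<Lambda> L"
proof -
  define J where "J = trace_ideal \<Lambda> L"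
  have J: "Z.subspace J" unfolding J_def trace_ideal_def by (intro lat_mult_subgroup proper_latticesD(2)[OF L])
  define \<eta> where "\<eta> = scale (1 / of_int a) \<omega>"
  define \<beta> where "\<beta> = \<omega> - of_int b"
  have dual: "1 \<in> dual \<Lambda>" "\<eta> \<in> dual \<Lambda>"
    using a_nz by (simp_all add: mem_dual_order_iff \<eta>_def)
  have ints: "of_int a * k1 z * r \<in> \<int>" if "z \<in> dual \<Lambda>" "r \<in> \<int>" for z r
    using that by (simp add: mem_dual_order_iff)
  have inv: "of_int a \<in> colon \<Lambda> (dual \<Lambda>)" "\<theta> \<in> colon \<Lambda> (dual \<Lambda>)" "\<beta> \<in> colon \<Lambda> (dual \<Lambda>)"
    using ints[of _ "of_int d"] ints[of _ "of_int c"]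
    by (auto simp: colon_def mem_dual_order_iff mem_order_iff coords_mult \<beta>_def algebra_simps)
  note prods = colon_dual_order_mult_subset_trace[OF L, folded J_def]
  show a: "of_int a \<in> trace_ideal \<Lambda> L" using prods[OF inv(1) dual(1)] by (simp add: J_def)
  have "of_int a * \<eta> = \<omega>" using a_nz by (simp add: \<eta>_def coords_eq_iff)
  then have \<omega>: "\<omega> \<in> J" using prods[OF inv(1) dual(2)] by simp
  have \<beta>: "\<beta> \<in> J" and \<theta>: "\<theta> \<in> J" using prods[OF inv(3) dual(1)] prods[OF inv(2) dual(1)] by simp_all
  show "of_int b \<in> trace_ideal \<Lambda> L"
    using Z.subspace_diff[OF J \<omega> \<beta>] by (simp add: \<beta>_def J_def)
  have "of_int c = - (\<beta> * \<eta>) - \<theta>" "of_int d = - (\<theta> * \<eta>)"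
    using a_nz by (simp_all add: coords_eq_iff \<beta>_def \<eta>_def coords_mult)
  then show "of_int c \<in> trace_ideal \<Lambda> L" "of_int d \<in> trace_ideal \<Lambda> L"
    using prods[OF inv(3) dual(2)] prods[OF inv(2) dual(2)] \<theta>
    by (auto simp flip: J_def intro!: Z.subspace_diff[OF J] Z.subspace_neg[OF J])
qed

lemma singular_primes_dvd_content:
  assumes "L \<in> proper_lattices" "p \<in> singular_primes L"
  shows "int p dvd a" "int p dvd b" "int p dvd c" "int p dvd d"
  using assms content_in_trace_ideal[OF assms(1)] by (auto simp: singular_primes_def)

text \<open>If \<open>A * I - F * H\<close> is prime to \<open>p\<close>, then so is \<open>A\<close> or \<open>H\<close>; exchanging \<open>y\<close> and \<open>z\<close> reduces the second
  case to the first one, where \<open>generator_gives_coprime_trace\<close> contradicts the choice of \<open>p\<close>.\<close>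

lemma singular_prime_pairing_dependent:
  assumes p: "p \<in> singular_primes K" and dvd: "int p dvd a" "int p dvd b"
    and K: "\<And>u l. u \<in> \<Lambda> \<Longrightarrow> l \<in> K \<Longrightarrow> u * l \<in> K"
    and M: "\<And>l y. l \<in> K \<Longrightarrow> y \<in> M \<Longrightarrow> k2 (l * y) \<in> \<int>"
    and l: "l \<in> K" and y: "y \<in> M" and z: "z \<in> M"
    and ints: "of_int A = k2 (\<omega> * (l * y))" "of_int F = k2 (\<theta> * (l * y))"
      "of_int H = k2 (\<omega> * (l * z))" "of_int I = k2 (\<theta> * (l * z))"
  shows "int p dvd A * I - F * H"
proof (rule ccontr)
  assume nd: "\<not> ?thesis"
  have prime: "prime p" using p by (simp add: singular_primes_def)
  have gen: "\<exists>n. of_int n \<in> trace_ideal \<Lambda> K \<and> \<not> int p dvd n"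
    if "y \<in> M" "z \<in> M" "of_int A = k2 (\<omega> * (l * y))" "of_int F = k2 (\<theta> * (l * y))"
      "of_int H = k2 (\<omega> * (l * z))" "of_int I = k2 (\<theta> * (l * z))"
      "\<not> int p dvd A" "\<not> int p dvd A * I - F * H" for y z A F H I
    by (rule generator_gives_coprime_trace[OF prime dvd, of K M l y z A F H I])
      (use K M l that in blast)+
  have "\<exists>n. of_int n \<in> trace_ideal \<Lambda> K \<and> \<not> int p dvd n"
  proof (cases "int p dvd A")
    case False
    show ?thesis by (rule gen[OF y z ints False nd])
  next
    case True
    then have H: "\<not> int p dvd H" using nd by auto
    have "\<not> int p dvd H * F - I * A"
      using nd dvd_diff_commute[of "int p" "H * F"] by (simp add: mult.commute)
    then show ?thesis by (rule gen[OF z y ints(3,4,1,2) H])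
  qed
  then show False using p by (auto simp: singular_primes_def)
qed

text \<open>If \<open>p\<close> were singular for both lattices, the two forms on \<open>L \<times> L*\<close> given by \<open>\<omega>\<close> and \<open>\<theta>\<close> would be
  dependent modulo \<open>p\<close> after fixing either argument, hence satisfy a single relation with
  coefficients \<open>s\<close> and \<open>t\<close>. Then \<open>u = (s \<omega> + t \<theta>) / p\<close> maps \<open>L\<close> into \<open>L** = L\<close> without being in \<open>\<Lambda>\<close>.\<close>

lemma singular_primes_dual_disjoint:
  assumes L: "L \<in> proper_lattices" and p: "p \<in> singular_primes L"
  shows "p \<notin> singular_primes (dual L)"
proof
  assume p': "p \<in> singular_primes (dual L)"
  note sub = proper_latticesD(2)[OF L] and full = proper_latticesD(1)[OF L]
  have prime: "prime p" using p by (simp add: singular_primes_def)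
  note dvd = singular_primes_dvd_content[OF L p]
  have pairing: "k2 (u * (l * y)) \<in> \<int>" if "u \<in> \<Lambda>" "l \<in> L" "y \<in> dual L" for u l y
    using dualD[OF that(3) proper_latticesD(3)[OF L that(1,2)]] by (simp add: mult.assoc)
  define P where "P l y = \<lfloor>k2 (\<omega> * (l * y))\<rfloor>" for l y
  define Q where "Q l y = \<lfloor>k2 (\<theta> * (l * y))\<rfloor>" for l y
  have PQ: "of_int (P l y) = k2 (\<omega> * (l * y))" "of_int (Q l y) = k2 (\<theta> * (l * y))"
    if "l \<in> L" "y \<in> dual L" for l y
    using pairing[OF basis_in_order(2) that] pairing[OF basis_in_order(3) that]
    by (simp_all add: P_def Q_def)
  have left: "int p dvd P l y * Q l z - P l z * Q l y"
    if l: "l \<in> L" and y: "y \<in> dual L" and z: "z \<in> dual L" for l y z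
  proof -
    have "int p dvd P l y * Q l z - Q l y * P l z"
      by (rule singular_prime_pairing_dependent[where K = L and M = "dual L" and l = l and y = y and z = z,
            OF p dvd(1,2)])
        (use l y z PQ proper_latticesD(3)[OF L] dualD in auto)
    then show ?thesis by (simp add: mult.commute)
  qed
  have right: "int p dvd P l y * Q m y - P m y * Q l y"
    if l: "l \<in> L" and m: "m \<in> L" and y: "y \<in> dual L" for l m y
  proof -
    have "int p dvd P l y * Q m y - Q l y * P m y"
    proof (rule singular_prime_pairing_dependent[where K = "dual L" and M = L and l = y and y = l and z = m,
          OF p' dvd(1,2)])
      show "k2 (y * l) \<in> \<int>" if "y \<in> dual L" "l \<in> L" for y l
        using dualD[OF that] by (simp add: mult.commute)
    qed (use l m y PQ dual_module[OF L] in \<open>auto simp: mult.commute[of y]\<close>)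
    then show ?thesis by (simp add: mult.commute)
  qed
  obtain s t where st: "\<not> (int p dvd s \<and> int p dvd t)"
    "\<And>l y. l \<in> L \<Longrightarrow> y \<in> dual L \<Longrightarrow> int p dvd s * P l y + t * Q l y"
  proof (rule pencil_of_locally_dependent_forms[where L = L and M = "dual L" and P = P and Q = Q and p = "int p"])
    fix l m y assume lmy: "l \<in> L" "m \<in> L" "y \<in> dual L"
    then have lm: "l + m \<in> L" using Z.subspace_add[OF sub] by blast
    have "of_int (P (l + m) y) = (of_int (P l y + P m y) :: rat)"
      "of_int (Q (l + m) y) = (of_int (Q l y + Q m y) :: rat)"
      using lmy lm by (simp_all add: PQ distrib_left distrib_right)
    then show "P (l + m) y = P l y + P m y" "Q (l + m) y = Q l y + Q m y"
      by (simp_all only: of_int_eq_iff)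
  qed (use prime left right Z.subspace_add[OF sub] in auto)
  define u where "u = scale (1 / of_nat p) (of_int s * \<omega> + of_int t * \<theta>)"
  have p0: "(of_nat p :: rat) \<noteq> 0" using prime by auto
  have "u * l \<in> L" if l: "l \<in> L" for l
  proof -
    have "k2 (y * (u * l)) \<in> \<int>" if y: "y \<in> dual L" for y
    proof -
      obtain k where k: "s * P l y + t * Q l y = int p * k" using st(2)[OF l y] by (rule dvdE)
      have "y * (u * l) = scale (1 / of_nat p) (of_int s * (\<omega> * (l * y)) + of_int t * (\<theta> * (l * y)))"
        by (simp add: u_def scale_mult_left scale_mult_right distrib_left distrib_right ac_simps)
      then have "k2 (y * (u * l)) = of_int (s * P l y + t * Q l y) / of_nat p"
        using PQ[OF l y] by simp
      also have "\<dots> = of_int k" unfolding k using p0 by simp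
      finally show ?thesis by simp
    qed
    then show ?thesis using bidual[OF full] unfolding dual_def[of "dual L"] by blast
  qed
  then have "u \<in> \<Lambda>" by (rule proper_latticesD(4)[OF L])
  then have "of_int s / of_nat p \<in> (\<int> :: rat set)" "of_int t / of_nat p \<in> (\<int> :: rat set)"
    by (simp_all add: mem_order_iff u_def)
  then obtain i j where "of_int s / of_nat p = (of_int i :: rat)" "of_int t / of_nat p = (of_int j :: rat)"
    by (auto elim!: Ints_cases)
  then have "(of_int s :: rat) = of_int (int p * i)" "(of_int t :: rat) = of_int (int p * j)"
    using p0 by (simp_all add: field_simps)
  then have "s = int p * i" "t = int p * j" by (simp_all only: of_int_eq_iff)
  then show False using st(1) by simp
qed

text \<open>Multiplication is self-adjoint for the pairing, so \<open>M : L\<close> coincides with \<open>L* : M*\<close>, and the argument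
  of \<open>trace_ideals_mult\<close> applies to the dual lattices.\<close>

lemma dual_trace_ideals_mult:
  assumes L: "L \<in> proper_lattices" and M: "M \<in> proper_lattices"
    and m: "of_int m \<in> trace_ideal \<Lambda> (dual L)" and n: "of_int n \<in> trace_ideal \<Lambda> (dual M)"
  shows "of_int (m * n) \<in> lat_mult (colon M L) (colon L M)"
proof -
  have colon: "y * x \<in> colon N K"
    if K: "K \<in> proper_lattices" and N: "N \<in> proper_lattices" and y: "y \<in> dual K" and x: "x \<in> colon \<Lambda> (dual N)" for K N x y
    unfolding colon_def
  proof (intro CollectI ballI)
    fix k assume k: "k \<in> K"
    have "k2 (z * (y * x * k)) \<in> \<int>" if z: "z \<in> dual N" for z
      using dualD[OF dual_module[OF K colonD[OF x z] y] k] by (simp add: ac_simps)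
    then have "y * x * k \<in> dual (dual N)" by (simp add: dual_def)
    then show "y * x * k \<in> N" by (simp add: bidual proper_latticesD(1)[OF N])
  qed
  have sub: "Z.subspace (lat_mult (colon M L) (colon L M))"
    by (intro lat_mult_subgroup colon_subgroup proper_latticesD(2)[OF M])
  have "of_int m * of_int n \<in> lat_mult (colon M L) (colon L M)"
  proof (rule lat_mult_pair_mem[OF sub _ m[unfolded trace_ideal_def] n[unfolded trace_ideal_def]])
    fix y x y' x'
    assume yx: "y \<in> dual L" "x \<in> colon \<Lambda> (dual L)" "y' \<in> dual M" "x' \<in> colon \<Lambda> (dual M)"
    then show "(y * x) * (y' * x') \<in> lat_mult (colon M L) (colon L M)"
      using lat_multI[OF colon[OF L M yx(1,4)] colon[OF M L yx(3,2)]] by (simp add: ac_simps)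
  qed
  then show ?thesis by simp
qed

lemma w_equiv_iff_singular_primes:
  assumes L: "L \<in> proper_lattices" and M: "M \<in> proper_lattices"
  shows "(L, M) \<in> w_equiv \<longleftrightarrow> singular_primes L = singular_primes M"
proof
  assume eq: "singular_primes L = singular_primes M"
  define E where "E = lat_mult (colon M L) (colon L M)"
  have E: "Z.subspace E" unfolding E_def by (intro lat_mult_subgroup colon_subgroup proper_latticesD(2)[OF M])
  have G: "Z.subspace {n :: int. of_int n \<in> E}"
    using E unfolding Z.subspace_def by simp
  have "1 \<in> {n :: int. of_int n \<in> E}"
  proof (rule ccontr)
    assume "1 \<notin> {n :: int. of_int n \<in> E}"
    then obtain p :: nat where p: "prime p" "\<And>n. of_int n \<in> E \<Longrightarrow> int p dvd n"
      by (rule proper_int_subgroup_in_prime_multiples[OF G]) simp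
    have "\<exists>m n. \<not> int p dvd m \<and> \<not> int p dvd n \<and> of_int (m * n) \<in> E"
    proof (cases "p \<in> singular_primes L")
      case True
      then have "p \<notin> singular_primes (dual L)" "p \<notin> singular_primes (dual M)"
        using eq singular_primes_dual_disjoint L M by auto
      then obtain m n where "\<not> int p dvd m" "of_int m \<in> trace_ideal \<Lambda> (dual L)"
        "\<not> int p dvd n" "of_int n \<in> trace_ideal \<Lambda> (dual M)"
        using p(1) unfolding singular_primes_def by blast
      then show ?thesis using dual_trace_ideals_mult[OF L M] unfolding E_def by blast
    next
      case False
      then obtain m n where "\<not> int p dvd m" "of_int m \<in> trace_ideal \<Lambda> L"
        "\<not> int p dvd n" "of_int n \<in> trace_ideal \<Lambda> M"
        using p(1) eq unfolding singular_primes_def by blast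
      then show ?thesis using trace_ideals_mult[OF L M] unfolding E_def by blast
    qed
    then show False using p by (metis prime_dvd_mult_iff prime_nat_int_transfer)
  qed
  then show "(L, M) \<in> w_equiv"
    by (intro w_equivI proper_latticesD(1)[OF L] proper_latticesD(1)[OF M]) (simp add: E_def)
qed (rule singular_primes_w_equiv)

text \<open>The lattice glues \<open>\<Lambda>*\<close> at the primes in \<open>T\<close> to \<open>\<Lambda>\<close> at all other primes. It contains \<open>1\<close>, and \<open>a1\<close>
  maps it into \<open>\<Lambda>\<close>, so \<open>a1\<close> lies in its trace ideal and only primes of \<open>T\<close> can be singular.
  Conversely, if \<open>p \<in> T\<close> and \<open>x\<close> maps the lattice into \<open>\<Lambda>\<close>, then integrality of \<open>x * \<eta>\<close> forces \<open>p\<close> to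
  divide the constant coefficient of \<open>x\<close>, and all elements of the trace ideal inherit this property.\<close>

lemma realize_singular_primes:
  assumes T: "\<And>p. p \<in> T \<Longrightarrow> prime p \<and> int p dvd a \<and> int p dvd b \<and> int p dvd c \<and> int p dvd d"
  obtains L where "L \<in> proper_lattices" "singular_primes L = T"
proof -
  obtain a1 a2 where a12: "a = a1 * a2" and cop: "coprime a1 a2"
    and dvd1: "\<And>p. prime p \<Longrightarrow> int p dvd a1 \<longleftrightarrow> p \<in> T"
    using coprime_part_factorization[OF a_nz, of T] T by blast
  have nz: "a1 \<noteq> 0" "(of_int a1 :: rat) \<noteq> 0" using a12 a_nz by auto
  define L where "L = {x. k0 x \<in> \<int> \<and> of_int a1 * k1 x \<in> \<int> \<and> k2 x \<in> \<int>}"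
  define \<eta> where "\<eta> = scale (1 / of_int a1) \<omega>"
  have sub: "Z.subspace L"
    by (rule Z.subspaceI) (auto simp: L_def distrib_left mult.left_commute[of "of_int a1"])
  have \<Lambda>L: "\<Lambda> \<subseteq> L" by (auto simp: L_def mem_order_iff)
  have a1L: "of_int a1 * x \<in> \<Lambda>" if "x \<in> L" for x using that by (auto simp: L_def mem_order_iff)
  have full: "full_lattice L"
  proof (rule full_latticeI[OF is_orderD(1)[OF order] sub nz(1) a1L])
    show "\<exists>m::int. m \<noteq> 0 \<and> of_int m * x \<in> L" for x
      using full_lattice_absorbs[OF is_orderD(1)[OF order], of x] \<Lambda>L by blast
  qed
  have mem: "1 \<in> L" "\<eta> \<in> L" using nz by (simp_all add: L_def \<eta>_def)
  have mod: "u * x \<in> L" if u: "u \<in> \<Lambda>" and x: "x \<in> L" for u x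
  proof -
    have "k0 (u * x) = k0 u * k0 x - of_int (a2 * c) * (k1 u * (of_int a1 * k1 x))
      - of_int a2 * of_int d * (of_int a1 * k1 u * k2 x + k2 u * (of_int a1 * k1 x)) - of_int (b * d) * (k2 u * k2 x)"
      "of_int a1 * k1 (u * x) = k0 u * (of_int a1 * k1 x) + of_int a1 * k1 u * k0 x
      + of_int b * (k1 u * (of_int a1 * k1 x)) + of_int a1 * of_int d * (k2 u * k2 x)"
      "k2 (u * x) = k0 u * k2 x + k2 u * k0 x - of_int a2 * (k1 u * (of_int a1 * k1 x)) - of_int c * (k2 u * k2 x)"
      by (simp_all add: coords_mult a12 algebra_simps)
    with u x show ?thesis by (simp add: L_def mem_order_iff)
  qed
  have "order_of L \<subseteq> \<Lambda>"
  proof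
    fix x assume "x \<in> order_of L"
    then have x: "x * y \<in> L" if "y \<in> L" for y using that by (simp add: order_of_eq_colon colonD)
    from x[OF mem(1)] have xL: "x \<in> L" by simp
    then obtain i j k where ijk: "k0 x = of_int i" "of_int a1 * k1 x = of_int j" "k2 x = of_int k"
      by (auto simp: L_def elim!: Ints_cases)
    have "k2 (x * \<eta>) = - (of_int a2 * of_int j / of_int a1)"
      using nz by (simp add: coords_mult \<eta>_def a12 flip: ijk)
    moreover have "k2 (x * \<eta>) \<in> \<int>" using x[OF mem(2)] by (simp add: L_def)
    ultimately have "of_int a2 * of_int j / of_int a1 \<in> (\<int> :: rat set)" by simp
    then obtain m where "of_int a2 * of_int j / of_int a1 = (of_int m :: rat)" by (auto elim: Ints_cases)
    then have "(of_int (a2 * j) :: rat) = of_int (a1 * m)" using nz by (simp add: field_simps)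
    then have "a2 * j = a1 * m" by (simp only: of_int_eq_iff)
    then have "a1 dvd j" using cop by (metis coprime_dvd_mult_right_iff dvd_triv_left)
    then obtain j' where "j = a1 * j'" by (rule dvdE)
    then have "k1 x = of_int j'" using ijk(2) nz by simp
    with ijk show "x \<in> \<Lambda>" by (simp add: mem_order_iff)
  qed
  moreover have "\<Lambda> \<subseteq> order_of L" using mod by (auto simp: order_of_eq_colon colon_def)
  ultimately have L: "L \<in> proper_lattices" using full by (simp add: proper_lattices_def)
  have "p \<in> singular_primes L \<longleftrightarrow> p \<in> T" if p: "prime p" for p
  proof
    assume "p \<in> singular_primes L"
    moreover have "of_int a1 \<in> colon \<Lambda> L" using a1L by (simp add: colon_def)
    then have "of_int a1 \<in> trace_ideal \<Lambda> L"
      unfolding trace_ideal_def using lat_multI[OF mem(1), of "of_int a1"] by simp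
    ultimately show "p \<in> T" using dvd1[OF p] by (simp add: singular_primes_def)
  next
    assume "p \<in> T"
    then have pd: "int p dvd a1" "int p dvd b" "int p dvd c" "int p dvd d" using T dvd1[OF p] by auto
    define M where "M = {x. \<exists>i :: int. k0 x = of_int (int p * i)}"
    have M: "Z.subspace M"
    proof (rule Z.subspaceI)
      show "0 \<in> M" unfolding M_def by (auto intro!: exI[of _ 0])
      show "x + y \<in> M" if "x \<in> M" "y \<in> M" for x y
      proof -
        obtain i j where "k0 x = of_int (int p * i)" "k0 y = of_int (int p * j)"
          using \<open>x \<in> M\<close> \<open>y \<in> M\<close> unfolding M_def by blast
        then show ?thesis unfolding M_def by (auto intro!: exI[of _ "i + j"] simp: distrib_left)
      qed
      show "of_int n * x \<in> M" if "x \<in> M" for n x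
      proof -
        obtain i where "k0 x = of_int (int p * i)" using \<open>x \<in> M\<close> unfolding M_def by blast
        then show ?thesis unfolding M_def by (auto intro!: exI[of _ "n * i"])
      qed
    qed
    have "trace_ideal \<Lambda> L \<subseteq> M"
      unfolding trace_ideal_def
    proof (rule lat_mult_least[OF M])
      fix l x assume l: "l \<in> L" and x: "x \<in> colon \<Lambda> L"
      have "x \<in> \<Lambda>" using colonD[OF x mem(1)] by simp
      then obtain i j k where x_ints: "k0 x = of_int i" "k1 x = of_int j" "k2 x = of_int k"
        by (auto simp: mem_order_iff elim!: Ints_cases)
      obtain l0 l1 l2 where l_ints: "k0 l = of_int l0" "of_int a1 * k1 l = of_int l1" "k2 l = of_int l2"
        using l by (auto simp: L_def elim!: Ints_cases)
      have "k1 (x * \<eta>) \<in> \<int>" using colonD[OF x mem(2)] by (simp add: mem_order_iff)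
      moreover have "k1 (x * \<eta>) = of_int (i + b * j) / of_int a1"
        using nz by (simp add: coords_mult \<eta>_def x_ints field_simps)
      ultimately obtain m where "of_int (i + b * j) / of_int a1 = (of_int m :: rat)"
        by (auto elim: Ints_cases)
      then have "(of_int (i + b * j) :: rat) = of_int (a1 * m)" using nz by (simp add: field_simps)
      then have "i + b * j = a1 * m" by (simp only: of_int_eq_iff)
      then have "i = a1 * m - b * j" by simp
      then have "int p dvd i" using pd by simp
      then have "int p dvd l0 * i - a2 * c * l1 * j - a2 * d * l1 * k - a * d * l2 * j - b * d * l2 * k"
        using pd by simp
      then obtain q where
        "l0 * i - a2 * c * l1 * j - a2 * d * l1 * k - a * d * l2 * j - b * d * l2 * k = int p * q"
        by (rule dvdE)
      moreover have "k0 (l * x) = k0 l * k0 x - of_int (a2 * c) * (of_int a1 * k1 l) * k1 x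
          - of_int (a2 * d) * (of_int a1 * k1 l) * k2 x - of_int (a * d) * k2 l * k1 x
          - of_int (b * d) * k2 l * k2 x"
        by (simp add: coords_mult a12 algebra_simps)
      then have "k0 (l * x) = of_int (l0 * i - a2 * c * l1 * j - a2 * d * l1 * k - a * d * l2 * j - b * d * l2 * k)"
        by (simp add: x_ints l_ints)
      ultimately show "l * x \<in> M" unfolding M_def by auto
    qed
    then have "int p dvd n" if "of_int n \<in> trace_ideal \<Lambda> L" for n
    proof -
      have "of_int n \<in> M" using that \<open>trace_ideal \<Lambda> L \<subseteq> M\<close> by blast
      then obtain i where "(of_int n :: rat) = of_int (int p * i)" unfolding M_def by auto
      then have "n = int p * i" by (simp only: of_int_eq_iff)
      then show ?thesis by simp
    qed
    then show "p \<in> singular_primes L" using p by (simp add: singular_primes_def)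
  qed
  moreover have "prime p" if "p \<in> singular_primes L" for p using that by (simp add: singular_primes_def)
  ultimately have "singular_primes L = T" using T by blast
  then show ?thesis using that L by blast
qed

lemma tau_eq_power_of_two:
  "\<exists>\<mu>::nat. \<mu> \<ge> 1 \<and> tau \<Lambda> = 2 ^ card {p::nat. prime p \<and> p dvd \<mu>}"
proof -
  define \<mu> where "\<mu> = nat (gcd (gcd a b) (gcd c d))"
  have \<mu>: "\<mu> \<ge> 1" using a_nz by (simp add: \<mu>_def Suc_le_eq)
  have dvd: "p dvd \<mu> \<longleftrightarrow> int p dvd a \<and> int p dvd b \<and> int p dvd c \<and> int p dvd d" for p
    by (auto simp: \<mu>_def nat_dvd_iff simp flip: int_dvd_int_iff)
  define R where "R = {p::nat. prime p \<and> p dvd \<mu>}"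
  have "finite R" unfolding R_def using \<mu> by (intro finite_subset[OF _ finite_atMost[of \<mu>]]) (auto dest: dvd_imp_le)
  have "tau \<Lambda> = card (singular_primes ` proper_lattices)"
    unfolding proper_lattices_def by (rule tau_eq_card_invariant) (use w_equiv_iff_singular_primes in \<open>simp add: proper_lattices_def\<close>)
  moreover have "singular_primes ` proper_lattices = Pow R"
  proof
    show "singular_primes ` proper_lattices \<subseteq> Pow R"
      using singular_primes_dvd_content by (auto simp: R_def dvd singular_primes_def)
    show "Pow R \<subseteq> singular_primes ` proper_lattices"
    proof
      fix T assume "T \<in> Pow R"
      then have "\<And>p. p \<in> T \<Longrightarrow> prime p \<and> int p dvd a \<and> int p dvd b \<and> int p dvd c \<and> int p dvd d"
        by (auto simp: R_def dvd)
      then obtain L where "L \<in> proper_lattices" "singular_primes L = T" by (rule realize_singular_primes)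
      then show "T \<in> singular_primes ` proper_lattices" by blast
    qed
  qed
  ultimately have "tau \<Lambda> = 2 ^ card R" using \<open>finite R\<close> by (simp add: card_Pow)
  then show ?thesis using \<mu> unfolding R_def by blast
qed

end

section \<open>Integral bases with unit\<close>

text \<open>In lowest terms \<open>q = u / v\<close>, every power of \<open>v\<close> divides \<open>N\<close>.\<close>

lemma rat_bounded_powers_imp_int:
  fixes q :: rat and N :: int
  assumes N: "N \<noteq> 0" and pow: "\<And>n. of_int N * q ^ n \<in> \<int>"
  shows "q \<in> \<int>"
proof -
  obtain u v where uv: "quotient_of q = (u, v)" by (cases "quotient_of q")
  have q: "q = of_int u / of_int v" and v: "v > 0" and cop: "coprime u v"
    using quotient_of_div[OF uv] quotient_of_denom_pos[OF uv] quotient_of_coprime[OF uv] by auto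
  have dvd: "v ^ n dvd N" for n
  proof -
    obtain m where "of_int N * q ^ n = of_int m" using pow[of n] by (auto elim: Ints_cases)
    then have "(of_int (N * u ^ n) :: rat) = of_int (m * v ^ n)"
      using v by (simp add: q power_divide field_simps)
    then have "N * u ^ n = m * v ^ n" by (simp only: of_int_eq_iff)
    then have "v ^ n dvd N * u ^ n" by simp
    moreover have "coprime (v ^ n) (u ^ n)" using cop by (simp add: coprime_commute)
    ultimately show ?thesis by (simp add: coprime_dvd_mult_left_iff)
  qed
  have "v = 1"
  proof (rule ccontr)
    assume "v \<noteq> 1"
    then have "2 \<le> v" using v by simp
    define n where "n = nat \<bar>N\<bar>"
    have "\<bar>N\<bar> < 2 ^ n"
      using of_nat_less_two_power[of n, where 'a = int] by (simp add: n_def)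
    also have "\<dots> \<le> v ^ n" using \<open>2 \<le> v\<close> by (intro power_mono) auto
    finally show False using dvd_imp_le_int[OF N dvd[of n]] v by simp
  qed
  then show ?thesis using q by simp
qed

context rat_algebra
begin

lemma triple_of_int:
  "triple \<omega> \<theta> (of_int i) (of_int j) (of_int k) = of_int i + of_int j * \<omega> + of_int k * \<theta>"
  using of_int_mult_eq_scale[of i 1] by (simp add: triple_def of_int_mult_eq_scale[of _ \<omega>] of_int_mult_eq_scale[of _ \<theta>])

lemma rational_basis_with_one:
  obtains B where "(1 :: 'a) \<in> B" "rat.independent B" "rat.span B = UNIV"
proof -
  obtain B where "{1} \<subseteq> B" "B \<subseteq> UNIV" "rat.independent B" "UNIV \<subseteq> rat.span B"
    using rat.maximal_independent_subset_extend[of "{1}" UNIV] by auto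
  then show ?thesis using that by auto
qed

lemma order_rational_elements:
  assumes \<Lambda>: "is_order \<Lambda>" and q: "scale q 1 \<in> \<Lambda>"
  shows "q \<in> \<int>"
proof -
  obtain B where B: "1 \<in> B" "rat.independent B" "rat.span B = UNIV" by (rule rational_basis_with_one)
  obtain N :: int where N: "N \<noteq> 0" "\<And>x. x \<in> \<Lambda> \<Longrightarrow> of_int N * x \<in> Z.span B"
    using full_lattice_bounded_coordinates[OF is_orderD(1)[OF \<Lambda>] B(3)] by blast
  define g where "g x = rat.representation B x 1" for x
  have "Z.subspace {x. g x \<in> \<int>}"
    using B by (intro Z.subspaceI) (auto simp: g_def rat.representation_zero rat.representation_add
      rat.representation_scale of_int_mult_eq_scale)
  then have int: "Z.span B \<subseteq> {x. g x \<in> \<int>}"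
    by (rule Z.span_minimal[rotated]) (auto simp: g_def rat.representation_basis[OF B(2)])
  have pow: "scale (q ^ n) 1 \<in> \<Lambda>" for n
  proof (induction n)
    case 0
    show ?case using is_orderD(2)[OF \<Lambda>] by simp
  next
    case (Suc n)
    then show ?case using is_orderD(3)[OF \<Lambda> q Suc] by (simp add: scale_mult_left)
  qed
  have "of_int N * q ^ n \<in> \<int>" for n
  proof -
    have "g (of_int N * scale (q ^ n) 1) \<in> \<int>" using N(2) pow int by blast
    moreover have "g (of_int N * scale (q ^ n) 1) = of_int N * q ^ n"
      using B by (simp add: g_def of_int_mult_eq_scale rat.representation_scale rat.representation_basis)
    ultimately show ?thesis by simp
  qed
  with N(1) show ?thesis by (rule rat_bounded_powers_imp_int)
qed

text \<open>Splitting off generators in the order \<open>v, u\<close> leaves the elements of \<open>\<Lambda>\<close> on the rational line through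
  \<open>1\<close>, and these are the integers. Treating \<open>1\<close> last is what makes it a member of the basis.\<close>

lemma order_generators:
  assumes dim: "rat.dim (UNIV :: 'a set) = 3" and \<Lambda>: "is_order \<Lambda>"
  obtains \<omega> \<theta> where "\<omega> \<in> \<Lambda>" "\<theta> \<in> \<Lambda>"
    "\<And>x. x \<in> \<Lambda> \<Longrightarrow> \<exists>i j k. x = of_int i + of_int j * \<omega> + of_int k * \<theta>"
proof -
  obtain B where B: "1 \<in> B" "rat.independent B" "rat.span B = UNIV" by (rule rational_basis_with_one)
  have "card B = 3" using rat.basis_card_eq_dim[of B UNIV] B dim by simp
  then have "card (B - {1}) = 2" using B(1) by simp
  then obtain u v where uv: "B - {1} = {u, v}" "u \<noteq> v" by (auto simp: card_2_iff)
  have B_eq: "B = insert v (insert u {1})" and ne: "u \<noteq> 1" "v \<noteq> 1" using uv B(1) by auto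
  obtain N :: int where N: "N \<noteq> 0" "\<And>x. x \<in> \<Lambda> \<Longrightarrow> of_int N * x \<in> Z.span B"
    using full_lattice_bounded_coordinates[OF is_orderD(1)[OF \<Lambda>] B(3)] by blast
  have sub: "Z.subspace \<Lambda>" using is_orderD(1)[OF \<Lambda>] by (rule full_lattice_subgroup)
  \<comment> \<open>\<open>\<Lambda>\<close> itself need not lie in the integral span of \<open>B\<close>, but its multiple by \<open>N\<close> does.\<close>
  define H where "H = (\<lambda>x. of_int N * x) ` \<Lambda>"
  have H: "Z.subspace H"
  proof (rule Z.subspaceI)
    show "0 \<in> H" unfolding H_def using Z.subspace_0[OF sub] by force
    show "x + y \<in> H" if "x \<in> H" "y \<in> H" for x y
      using that Z.subspace_add[OF sub] unfolding H_def by (auto simp flip: distrib_left)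
    show "of_int n * x \<in> H" if "x \<in> H" for n x
      using that Z.subspace_scale[OF sub] unfolding H_def
      by (auto simp: mult.left_commute[of "of_int n"])
  qed
  have HB: "H \<subseteq> Z.span (insert v {u, 1})" using N(2) B_eq unfolding H_def by auto
  have v: "v \<notin> {u, 1}" and u: "u \<notin> {1}" using uv ne by auto
  have ind: "rat.independent (insert v {u, 1})" "rat.independent (insert u {1})"
    using B(2) rat.independent_mono[OF B(2), of "{u, 1}"] unfolding B_eq by auto
  obtain h where h: "h \<in> H" "\<And>x. x \<in> H \<Longrightarrow> \<exists>k. x - of_int k * h \<in> H \<inter> Z.span {u, 1}"
    using split_off_generator[OF v ind(1) H HB] by blast
  have H': "Z.subspace (H \<inter> Z.span {u, 1})" using H by (intro Z.subspace_inter) simp_all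
  obtain h' where h': "h' \<in> H \<inter> Z.span {u, 1}"
    "\<And>x. x \<in> H \<inter> Z.span {u, 1} \<Longrightarrow> \<exists>k. x - of_int k * h' \<in> H \<inter> Z.span {u, 1} \<inter> Z.span {1}"
    using split_off_generator[OF u ind(2) H' Int_lower2] by blast
  obtain \<omega> \<theta> where \<omega>: "\<omega> \<in> \<Lambda>" "h' = of_int N * \<omega>" and \<theta>: "\<theta> \<in> \<Lambda>" "h = of_int N * \<theta>"
    using h(1) h'(1) unfolding H_def by blast
  have "\<exists>i j k. x = of_int i + of_int j * \<omega> + of_int k * \<theta>" if x: "x \<in> \<Lambda>" for x
  proof -
    have "of_int N * x \<in> H" using x unfolding H_def by blast
    then obtain k where k: "of_int N * x - of_int k * h \<in> H \<inter> Z.span {u, 1}" using h(2) by blast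
    obtain j where j: "of_int N * x - of_int k * h - of_int j * h' \<in> Z.span {1}" using h'(2)[OF k] by blast
    then obtain m where m: "of_int N * x - of_int k * h - of_int j * h' = of_int m"
      by (auto simp: Z.span_singleton)
    define y where "y = x - of_int k * \<theta> - of_int j * \<omega>"
    have "of_int N * y = of_int m"
      using m by (simp add: y_def \<theta>(2) \<omega>(2) right_diff_distrib mult.left_commute)
    then have "scale (of_int N) y = scale (of_int m) 1"
      using of_int_mult_eq_scale[of N y] of_int_mult_eq_scale[of m 1] by simp
    then have "scale (1 / of_int N) (scale (of_int N) y) = scale (1 / of_int N) (scale (of_int m) 1)" by simp
    then have y: "y = scale (of_int m / of_int N) 1" using N(1) by simp
    moreover have "y \<in> \<Lambda>"
      unfolding y_def using x \<theta>(1) \<omega>(1) by (intro Z.subspace_diff[OF sub] Z.subspace_scale[OF sub])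
    ultimately have "of_int m / of_int N \<in> (\<int> :: rat set)" using order_rational_elements[OF \<Lambda>] by simp
    then obtain i where "of_int m / of_int N = (of_int i :: rat)" by (auto elim: Ints_cases)
    then have "y = of_int i" using y of_int_mult_eq_scale[of i 1] by simp
    then have "x = of_int i + of_int j * \<omega> + of_int k * \<theta>" by (simp add: y_def algebra_simps)
    then show ?thesis by blast
  qed
  then show ?thesis using that \<omega>(1) \<theta>(1) by blast
qed

text \<open>Three elements that span a three-dimensional space are independent.\<close>

lemma order_basis_exists:
  assumes dim: "rat.dim (UNIV :: 'a set) = 3" and \<Lambda>: "is_order \<Lambda>"
  obtains \<omega> \<theta> where "order_basis \<Lambda> \<omega> \<theta>"
proof -
  obtain \<omega> \<theta> where \<omega>\<theta>: "\<omega> \<in> \<Lambda>" "\<theta> \<in> \<Lambda>"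
    and gen: "\<And>x. x \<in> \<Lambda> \<Longrightarrow> \<exists>i j k. x = of_int i + of_int j * \<omega> + of_int k * \<theta>"
    using order_generators[OF dim \<Lambda>] by blast
  have full: "full_lattice \<Lambda>" and 1: "1 \<in> \<Lambda>" using is_orderD[OF \<Lambda>] by auto
  have sub: "Z.subspace \<Lambda>" using full by (rule full_lattice_subgroup)
  have span: "\<exists>r s t. x = triple \<omega> \<theta> r s t" for x
  proof -
    obtain n :: int where n: "n \<noteq> 0" "of_int n * x \<in> \<Lambda>" using full_lattice_absorbs[OF full] .
    then obtain i j k where "scale (of_int n) x = triple \<omega> \<theta> (of_int i) (of_int j) (of_int k)"
      using gen[OF n(2)] by (auto simp: triple_of_int of_int_mult_eq_scale[of n])
    then have "scale (1 / of_int n) (scale (of_int n) x)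
        = triple \<omega> \<theta> (of_int i / of_int n) (of_int j / of_int n) (of_int k / of_int n)"
      by (simp add: scale_triple)
    then show ?thesis using n(1) by auto
  qed
  let ?E = "{1, \<omega>, \<theta>}"
  have spanE: "UNIV \<subseteq> rat.span ?E"
  proof
    fix x
    obtain r s t where "x = triple \<omega> \<theta> r s t" using span by blast
    then show "x \<in> rat.span ?E"
      unfolding triple_def by (auto intro!: rat.span_add rat.span_scale intro: rat.span_base)
  qed
  have "3 \<le> card ?E" using rat.dim_le_card[OF spanE] dim by simp
  then have dist: "1 \<noteq> \<omega>" "1 \<noteq> \<theta>" "\<omega> \<noteq> \<theta>" by (auto simp: card_insert_if split: if_splits)
  obtain B where B: "B \<subseteq> ?E" "rat.independent B" "?E \<subseteq> rat.span B"
    using rat.maximal_independent_subset by blast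
  have "UNIV \<subseteq> rat.span B" using spanE rat.span_minimal[OF B(3)] by auto
  then have "card B = card ?E" using rat.basis_card_eq_dim[of B UNIV] B(2) dim dist by simp
  then have "B = ?E" using B(1) by (intro card_subset_eq) auto
  then have ind: "rat.independent ?E" using B(2) by simp
  have zero: "r = 0 \<and> s = 0 \<and> t = 0" if "triple \<omega> \<theta> r s t = 0" for r s t
  proof -
    define f where "f x = (if x = 1 then r else if x = \<omega> then s else t)" for x
    have "(\<Sum>x\<in>?E. scale (f x) x) = 0"
      using that dist by (simp add: f_def triple_def add.assoc)
    then have "f x = 0" if "x \<in> ?E" for x
      using rat.independentD[OF ind, of ?E f x] that by simp
    from this[of 1] this[of \<omega>] this[of \<theta>] show ?thesis using dist by (auto simp: f_def)
  qed
  have "x \<in> \<Lambda> \<longleftrightarrow> (\<exists>i j k. x = triple \<omega> \<theta> (of_int i) (of_int j) (of_int k))" for x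
  proof
    show "\<exists>i j k. x = triple \<omega> \<theta> (of_int i) (of_int j) (of_int k)" if "x \<in> \<Lambda>"
      using gen[OF that] by (simp add: triple_of_int)
    assume "\<exists>i j k. x = triple \<omega> \<theta> (of_int i) (of_int j) (of_int k)"
    then obtain i j k where "x = of_int i * 1 + of_int j * \<omega> + of_int k * \<theta>"
      by (auto simp: triple_of_int)
    then show "x \<in> \<Lambda>"
      using 1 \<omega>\<theta> by (auto simp del: mult_1_right intro!: Z.subspace_add[OF sub] intro: Z.subspace_scale[OF sub])
  qed
  then show ?thesis using that span zero unfolding order_basis_def by blast
qed

end

section \<open>The binary cubic form of an order\<close>

context rat_algebra
begin

lemma order_basis_of_int_inject:
  assumes "order_basis \<Lambda> \<omega> \<theta>"
  shows "of_int i + of_int j * \<omega> + of_int k * \<theta> = of_int i' + of_int j' * \<omega> + of_int k' * \<theta>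
    \<longleftrightarrow> i = i' \<and> j = j' \<and> k = k'"
  unfolding triple_of_int[symmetric] order_basis_inject[OF assms] by simp

lemma order_basis_mem:
  assumes "order_basis \<Lambda> \<omega> \<theta>"
  shows "x \<in> \<Lambda> \<longleftrightarrow> (\<exists>i j k. x = of_int i + of_int j * \<omega> + of_int k * \<theta>)"
  using assms unfolding order_basis_def triple_of_int by blast

lemma mult_table_iff:
  "mult_table \<omega> \<theta> a b c d \<longleftrightarrow>
    \<omega> * \<omega> = of_int (- a * c) + of_int b * \<omega> + of_int (- a) * \<theta> \<and>
    \<omega> * \<theta> = of_int (- a * d) \<and>
    \<theta> * \<theta> = of_int (- b * d) + of_int d * \<omega> + of_int (- c) * \<theta>"
proof -
  have "triple \<omega> \<theta> (of_int i) 0 0 = of_int i" for i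
    using triple_of_int[of \<omega> \<theta> i 0 0] by simp
  note const = this
  show ?thesis unfolding mult_table_def triple_of_int const ..
qed

lemma order_basis_change:
  assumes B: "order_basis \<Lambda> \<omega> \<theta>"
  shows "order_basis \<Lambda> (\<omega> + of_int k * \<theta> + of_int m) (\<theta> + of_int n)"
proof -
  let ?t = "triple (\<omega> + of_int k * \<theta> + of_int m) (\<theta> + of_int n)"
  have eq: "?t r s t = triple \<omega> \<theta> (r + s * of_int m + t * of_int n) s (t + s * of_int k)" for r s t
    using of_int_mult_eq_scale[of m 1] of_int_mult_eq_scale[of n 1] of_int_mult_eq_scale[of k \<theta>]
    by (simp add: triple_def rat.scale_left_distrib rat.scale_right_distrib ac_simps)
  have inv: "triple \<omega> \<theta> r s t
    = ?t (r - s * of_int m - (t - s * of_int k) * of_int n) s (t - s * of_int k)" for r s t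
    unfolding eq by simp
  have "\<exists>r s t. x = ?t r s t" for x
    using B inv unfolding order_basis_def by metis
  moreover have "r = 0 \<and> s = 0 \<and> t = 0" if "?t r s t = 0" for r s t
  proof -
    have "r + s * of_int m + t * of_int n = 0 \<and> s = 0 \<and> t + s * of_int k = 0"
      using that B unfolding eq order_basis_def by blast
    then show ?thesis by auto
  qed
  moreover have "x \<in> \<Lambda> \<longleftrightarrow> (\<exists>i j l. x = ?t (of_int i) (of_int j) (of_int l))" for x
  proof
    assume "x \<in> \<Lambda>"
    then obtain i j l where x: "x = triple \<omega> \<theta> (of_int i) (of_int j) (of_int l)"
      using B unfolding order_basis_def by blast
    have "x = ?t (of_int (i - j * m - (l - j * k) * n)) (of_int j) (of_int (l - j * k))"
      unfolding x inv by simp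
    then show "\<exists>i j l. x = ?t (of_int i) (of_int j) (of_int l)" by blast
  next
    assume "\<exists>i j l. x = ?t (of_int i) (of_int j) (of_int l)"
    then obtain i j l where "x = ?t (of_int i) (of_int j) (of_int l)" by blast
    then have "x = triple \<omega> \<theta> (of_int (i + j * m + l * n)) (of_int j) (of_int (l + j * k))"
      unfolding eq by simp
    then show "x \<in> \<Lambda>" using B unfolding order_basis_def by blast
  qed
  ultimately show ?thesis unfolding order_basis_def by blast
qed

lemma order_basis_swap:
  assumes B: "order_basis \<Lambda> \<omega> \<theta>"
  shows "order_basis \<Lambda> \<theta> \<omega>"
proof -
  have "triple \<theta> \<omega> r s t = triple \<omega> \<theta> r t s" for r s t by (simp add: triple_def ac_simps)
  then show ?thesis using B unfolding order_basis_def by metis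
qed

text \<open>Translating \<open>\<omega>\<close> and \<open>\<theta>\<close> by integers removes them from the product \<open>\<omega> * \<theta>\<close>. The constant terms of the
  table are then read off by expanding \<open>\<omega> \<omega> \<theta>\<close> and \<open>\<omega> \<theta> \<theta>\<close> in two ways.\<close>

lemma normal_basis_exists:
  assumes \<Lambda>: "is_order \<Lambda>" and B: "order_basis \<Lambda> \<omega>0 \<theta>0"
  obtains \<omega> \<theta> a b c d where "order_basis \<Lambda> \<omega> \<theta>" "mult_table \<omega> \<theta> a b c d"
proof -
  have "of_int 0 + of_int 1 * \<omega>0 + of_int 0 * \<theta>0 \<in> \<Lambda>" "of_int 0 + of_int 0 * \<omega>0 + of_int 1 * \<theta>0 \<in> \<Lambda>"
    unfolding order_basis_mem[OF B] by blast+
  then have "\<omega>0 * \<theta>0 \<in> \<Lambda>" using is_orderD(3)[OF \<Lambda>] by simp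
  then obtain n0 e g where prod: "\<omega>0 * \<theta>0 = of_int n0 + of_int e * \<omega>0 + of_int g * \<theta>0"
    unfolding order_basis_mem[OF B] by blast
  define \<omega> where "\<omega> = \<omega>0 + of_int 0 * \<theta>0 + of_int (- g)"
  define \<theta> where "\<theta> = \<theta>0 + of_int (- e)"
  define n where "n = n0 + g * e"
  have B': "order_basis \<Lambda> \<omega> \<theta>" unfolding \<omega>_def \<theta>_def by (rule order_basis_change[OF B])
  have "\<omega> * \<theta> = \<omega>0 * \<theta>0 - of_int e * \<omega>0 - of_int g * \<theta>0 + of_int (g * e)"
    by (simp add: \<omega>_def \<theta>_def algebra_simps)
  then have wt: "\<omega> * \<theta> = of_int n" by (simp add: prod n_def)
  have "of_int 0 + of_int 1 * \<omega> + of_int 0 * \<theta> \<in> \<Lambda>" "of_int 0 + of_int 0 * \<omega> + of_int 1 * \<theta> \<in> \<Lambda>"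
    unfolding order_basis_mem[OF B'] by blast+
  then have "\<omega> * \<omega> \<in> \<Lambda>" "\<theta> * \<theta> \<in> \<Lambda>" using is_orderD(3)[OF \<Lambda>] by simp_all
  then obtain m b a' l d c' where ww: "\<omega> * \<omega> = of_int m + of_int b * \<omega> + of_int a' * \<theta>"
    and tt: "\<theta> * \<theta> = of_int l + of_int d * \<omega> + of_int c' * \<theta>"
    unfolding order_basis_mem[OF B'] by blast
  define a c where "a = - a'" and "c = - c'"
  have "(\<omega> * \<omega>) * \<theta> = \<omega> * (\<omega> * \<theta>)" by (rule mult.assoc)
  moreover have "(\<omega> * \<omega>) * \<theta> = of_int m * \<theta> + of_int b * (\<omega> * \<theta>) + of_int a' * (\<theta> * \<theta>)"
    unfolding ww by (simp add: algebra_simps)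
  also have "\<dots> = of_int (b * n + a' * l) + of_int (a' * d) * \<omega> + of_int (m + a' * c') * \<theta>"
    unfolding wt tt by (simp add: algebra_simps)
  moreover have "\<omega> * (\<omega> * \<theta>) = of_int 0 + of_int n * \<omega> + of_int 0 * \<theta>"
    unfolding wt by (simp add: mult.commute)
  ultimately have 1: "a' * d = n" "m + a' * c' = 0"
    using order_basis_of_int_inject[OF B'] by metis+
  have "\<omega> * (\<theta> * \<theta>) = (\<omega> * \<theta>) * \<theta>" by (simp add: mult.assoc)
  moreover have "\<omega> * (\<theta> * \<theta>) = of_int l * \<omega> + of_int d * (\<omega> * \<omega>) + of_int c' * (\<omega> * \<theta>)"
    unfolding tt by (simp add: algebra_simps)
  also have "\<dots> = of_int (d * m + c' * n) + of_int (l + d * b) * \<omega> + of_int (d * a') * \<theta>"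
    unfolding wt ww by (simp add: algebra_simps)
  moreover have "(\<omega> * \<theta>) * \<theta> = of_int 0 + of_int 0 * \<omega> + of_int n * \<theta>"
    unfolding wt by simp
  ultimately have 2: "l + d * b = 0"
    using order_basis_of_int_inject[OF B'] by metis
  have "m = - a * c" "n = - a * d" "l = - b * d"
    using 1 2 by (simp_all add: a_def c_def algebra_simps)
  then have "mult_table \<omega> \<theta> a b c d"
    unfolding mult_table_iff using ww wt tt by (simp add: a_def c_def)
  then show ?thesis using that B' by blast
qed

text \<open>The coefficient \<open>a\<close> is the value of the form at one vector of a basis of \<open>\<int> \<times> \<int>\<close>. If it vanishes
  at both basis vectors, then, since \<open>b\<close> and \<open>c\<close> are not both zero, the form does not vanish at the
  sum or at the difference of these vectors. The integers added to \<open>\<omega>\<close> below restore integrality of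
  \<open>\<omega> * \<theta>\<close>.\<close>

lemma nondegenerate_basis_exists:
  assumes B: "order_basis \<Lambda> \<omega> \<theta>" and table: "mult_table \<omega> \<theta> a b c d"
    and nz: "\<not> (a = 0 \<and> b = 0 \<and> c = 0 \<and> d = 0)"
  obtains \<omega>' \<theta>' a' b' c' d' where "order_basis \<Lambda> \<omega>' \<theta>'" "mult_table \<omega>' \<theta>' a' b' c' d'" "a' \<noteq> 0"
proof -
  note t = table[unfolded mult_table_iff]
  consider "a \<noteq> 0" | "d \<noteq> 0" | "a = 0" "d = 0" "b + c \<noteq> 0" | "a = 0" "d = 0" "c = - b" "b \<noteq> 0"
    using nz by force
  then show ?thesis
  proof cases
    case 1
    then show ?thesis using that B table by blast
  next
    case 2
    have "mult_table \<theta> \<omega> (- d) (- c) (- b) (- a)"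
      unfolding mult_table_iff using t by (simp add: algebra_simps)
    then show ?thesis using that[OF order_basis_swap[OF B]] 2 by simp
  next
    case 3
    have "mult_table (\<omega> + of_int 1 * \<theta> + of_int c) (\<theta> + of_int 0) (b + c) (b + 2 * c) c 0"
      unfolding mult_table_iff using t 3(1,2) by (simp add: algebra_simps)
    then show ?thesis using that[OF order_basis_change[OF B]] 3 by blast
  next
    case 4
    have "mult_table (\<omega> + of_int (- 1) * \<theta> + of_int b) (\<theta> + of_int 0) (- 2 * b) (3 * b) (- b) 0"
      unfolding mult_table_iff using t 4(1,2,3) by (simp add: algebra_simps)
    then show ?thesis using that[OF order_basis_change[OF B]] 4 by (metis mult_eq_0_iff neg_equal_0_iff_equal zero_neq_numeral)
  qed
qed

end

section \<open>The order of the zero form\<close>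

locale null_cubic_order = cubic_order scale \<Lambda> \<omega> \<theta> 0 0 0 0
  for scale :: "rat \<Rightarrow> 'a::comm_ring_1 \<Rightarrow> 'a" and \<Lambda> \<omega> \<theta>
begin

text \<open>Here the constant coefficient is a ring homomorphism whose kernel has square zero. Its values on \<open>L\<close>
  form a cyclic group, generated by the value at some unit \<open>u \<in> L\<close>. For \<open>l \<in> L\<close> the quotient \<open>l / u\<close>
  has integral constant coefficient \<open>m\<close>, and \<open>l / u - m\<close> acts on any \<open>l' \<in> L\<close> only through the constant
  coefficient of \<open>l'\<close>, so as on an integral multiple of \<open>u\<close>, with result in \<open>L\<close>. Hence \<open>l / u \<in> \<Lambda>\<close>,
  and \<open>1 = u (1 / u)\<close> lies in \<open>L (\<Lambda> : L)\<close>.\<close>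

lemma one_in_trace_ideal:
  assumes L: "L \<in> proper_lattices"
  shows "1 \<in> trace_ideal \<Lambda> L"
proof -
  note sub = proper_latticesD(2)[OF L] and full = proper_latticesD(1)[OF L]
  have sub\<Lambda>: "Z.subspace \<Lambda>" using is_orderD(1)[OF order] by (rule full_lattice_subgroup)
  obtain N :: int where N: "N \<noteq> 0" "\<And>x. x \<in> L \<Longrightarrow> of_int N * x \<in> \<Lambda>"
  proof (rule full_lattice_commensurable[OF full sub\<Lambda>])
    show "\<exists>n::int. n \<noteq> 0 \<and> of_int n * x \<in> \<Lambda>" for x
      using full_lattice_absorbs[OF is_orderD(1)[OF order], of x] by blast
  qed (rule that)
  define G where "G = {m :: int. \<exists>l\<in>L. of_int N * k0 l = of_int m}"
  have "Z.subspace G"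
  proof (rule Z.subspaceI)
    show "0 \<in> G" unfolding G_def using Z.subspace_0[OF sub] by (auto intro!: bexI[of _ 0])
    show "x + y \<in> G" if xy: "x \<in> G" "y \<in> G" for x y
    proof -
      obtain l m where "l \<in> L" "of_int N * k0 l = of_int x" "m \<in> L" "of_int N * k0 m = of_int y"
        using xy unfolding G_def by blast
      then show ?thesis unfolding G_def
        using Z.subspace_add[OF sub] by (auto intro!: bexI[of _ "l + m"] simp: distrib_left)
    qed
    show "of_int n * x \<in> G" if x: "x \<in> G" for n x
    proof -
      obtain l where "l \<in> L" "of_int N * k0 l = of_int x" using x unfolding G_def by blast
      then show ?thesis unfolding G_def
        using Z.subspace_scale[OF sub, of l n]
        by (auto intro!: bexI[of _ "of_int n * l"] simp: mult.left_commute[of "of_int N" "of_int n"])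
    qed
  qed
  then obtain g where g: "G = {n. g dvd n}" by (rule int_subgroup_cyclic)
  then have "g \<in> G" by simp
  then obtain u where u: "u \<in> L" "of_int N * k0 u = of_int g" unfolding G_def by blast
  have mult_u: "\<exists>k::int. k0 l = of_int k * k0 u" if l: "l \<in> L" for l
  proof -
    have "of_int N * k0 l \<in> \<int>" using N(2)[OF l] by (simp add: mem_order_iff)
    then obtain m where m: "of_int N * k0 l = of_int m" by (auto elim: Ints_cases)
    then have "m \<in> G" using l unfolding G_def by blast
    then obtain k where "m = g * k" using g by auto
    then have "of_int N * k0 l = of_int N * (of_int k * k0 u)" using m u(2) by simp
    then show ?thesis using N(1) by auto
  qed
  have u0: "k0 u \<noteq> 0"
  proof
    assume "k0 u = 0"
    obtain n :: int where "n \<noteq> 0" "of_int n * 1 \<in> L" using full_lattice_absorbs[OF full] .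
    then show False using mult_u[of "of_int n * 1"] \<open>k0 u = 0\<close> by simp
  qed
  define v where "v = triple \<omega> \<theta> (1 / k0 u) (- k1 u / (k0 u)\<^sup>2) (- k2 u / (k0 u)\<^sup>2)"
  have uv: "u * v = 1"
    using u0 by (simp add: coords_eq_iff coords_mult v_def power2_eq_square)
  have "v \<in> colon \<Lambda> L"
    unfolding colon_def
  proof (intro CollectI ballI)
    fix l assume l: "l \<in> L"
    obtain m where m: "k0 l = of_int m * k0 u" using mult_u[OF l] by blast
    have n0: "k0 (v * l - of_int m) = 0" using u0 by (simp add: coords_mult v_def m)
    have "v * l - of_int m \<in> \<Lambda>"
    proof (rule proper_latticesD(4)[OF L])
      fix l' assume l': "l' \<in> L"
      obtain m' where m': "k0 l' = of_int m' * k0 u" using mult_u[OF l'] by blast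
      have "(v * l - of_int m) * l' = (v * l - of_int m) * (of_int m' * u)"
        by (simp add: coords_eq_iff coords_mult[of "v * l - of_int m"] n0 m' del: coords_diff)
      also have "\<dots> = of_int m' * ((u * v) * l - of_int m * u)" by (simp add: algebra_simps)
      also have "\<dots> \<in> L"
        unfolding uv by (simp add: Z.subspace_scale[OF sub] Z.subspace_diff[OF sub] u(1) l)
      finally show "(v * l - of_int m) * l' \<in> L" .
    qed
    then have "(v * l - of_int m) + of_int m * 1 \<in> \<Lambda>"
      by (intro Z.subspace_add[OF sub\<Lambda>] Z.subspace_scale[OF sub\<Lambda>] basis_in_order)
    then show "v * l \<in> \<Lambda>" by simp
  qed
  then show ?thesis unfolding trace_ideal_def using lat_multI[OF u(1)] uv by metis
qed

lemma tau_eq_one: "tau \<Lambda> = 1"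
proof -
  have equiv: "(L, M) \<in> w_equiv" if "L \<in> proper_lattices" "M \<in> proper_lattices" for L M
    using trace_ideals_mult[OF that, of 1 1] one_in_trace_ideal that
    by (intro w_equivI proper_latticesD(1)) auto
  have "tau \<Lambda> = card ((\<lambda>_. ()) ` proper_lattices)"
    unfolding proper_lattices_def by (rule tau_eq_card_invariant) (use equiv in \<open>simp add: proper_lattices_def\<close>)
  moreover have "\<Lambda> \<in> proper_lattices"
    using is_orderD(1)[OF order] order_of_order[OF order] by (simp add: proper_lattices_def)
  then have "(\<lambda>_. ()) ` proper_lattices = {()}" by blast
  ultimately have "tau \<Lambda> = card {()}" by (simp only:)
  then show ?thesis by simp
qed

end

section \<open>The number of classes\<close>

theorem theorem5p8:
  fixes scale :: "rat \<Rightarrow> 'a::comm_ring_1 \<Rightarrow> 'a" and \<Lambda> :: "'a set"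
  assumes "rat_algebra scale"
    and "vector_space.dim scale (UNIV :: 'a set) = 3"
    and "rat_algebra.is_order scale \<Lambda>"
  shows "\<exists>\<mu>::nat. \<mu> \<ge> 1 \<and>
    rat_algebra.tau scale \<Lambda> = 2 ^ card {p::nat. prime p \<and> p dvd \<mu>}"
proof -
  interpret rat_algebra scale by fact
  obtain \<omega> \<theta> a b c d where B: "order_basis \<Lambda> \<omega> \<theta>" and table: "mult_table \<omega> \<theta> a b c d"
    using order_basis_exists[OF assms(2,3)] normal_basis_exists[OF assms(3)] by metis
  show ?thesis
  proof (cases "a = 0 \<and> b = 0 \<and> c = 0 \<and> d = 0")
    case True
    then interpret null_cubic_order scale \<Lambda> \<omega> \<theta>
      using assms(3) B table by unfold_locales auto
    have "{p::nat. prime p \<and> p dvd 1} = {}" by auto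
    then have "tau \<Lambda> = 2 ^ card {p::nat. prime p \<and> p dvd 1}" by (simp only: tau_eq_one card.empty power_0)
    then show ?thesis using le_refl by blast
  next
    case False
    then obtain \<omega>' \<theta>' a' b' c' d' where "order_basis \<Lambda> \<omega>' \<theta>'" "mult_table \<omega>' \<theta>' a' b' c' d'" "a' \<noteq> 0"
      using nondegenerate_basis_exists[OF B table] by metis
    then interpret nondegenerate_cubic_order scale \<Lambda> \<omega>' \<theta>' a' b' c' d'
      using assms(3) by unfold_locales
    show ?thesis by (rule tau_eq_power_of_two)
  qed
qed

end
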